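(* Let $A$ be a unital $C^*$-algebra with nonempty trace space $T(A)$, let $m\ge 1$, and let $\alpha:\mathbb{Z}^m\to\mathrm{Aut}(A)$ be a group action. If $\dim_{\mathrm{Rok}}(\alpha)=d<\infty$, then $\alpha$ is strongly outer.
   Context: $T(A)$ is the set of tracial states of $A$; $\alpha^v:=\alpha(v)$; $T(A)^{\alpha^v}$ is the set of $\alpha^v$-invariant traces; $\pi_\tau$ is the GNS representation of $\tau$. Strongly outer: for every $v\in\mathbb{Z}^m\setminus\{0\}$ and every $\tau\in T(A)^{\alpha^v}$, the extension $\tilde\alpha^v\in\mathrm{Aut}(\pi_\tau(A)'')$ of $\alpha^v$ is an outer automorphism (not of the form $\mathrm{Ad}\,W$ for a unitary $W\in\pi_\tau(A)''$). Rokhlin dimension: for $n\in\mathbb{N}$ let $B_n=\{0,1,\dots,n-1\}^m\subseteq\mathbb{Z}^m$; $v+w \bmod n\mathbb{Z}^m$ denotes the representative in $B_n$. We write $\dim_{\mathrm{Rok}}(\alpha)\le d$ if for any finite subset $F\subseteq A$, $\varepsilon>0$ and $n\in\mathbb{N}$ there exist positive contractions $(f_v^{(\ell)})_{v\in B_n}^{\ell=0,\dots,d}$ in $A$ such that: (1) $\|\alpha^w(f_v^{(\ell)})-f^{(\ell)}_{(v+w \bmod n\mathbb{Z}^m)}\|<\varepsilon$ for $0\le\ell\le d$, $v\in B_n$, $w\in\mathbb{Z}^m$; (2) $\|f_v^{(\ell)}f_{v'}^{(\ell)}\|<\varepsilon$ for $0\le \ell\le d$ and $v\ne v'$ in $B_n$;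 (3) $\|[f_v^{(\ell)},a]\|<\varepsilon$ for all $\ell$, $v\in B_n$, $a\in F$; (4) $\|\sum_{\ell=0}^d\sum_{v\in B_n}f_v^{(\ell)}-1_A\|<\varepsilon$. $\dim_{\mathrm{Rok}}(\alpha)$ is the least such $d$, or $\infty$ if there is none. *)

theory Defs
  imports "HOL-Analysis.Analysis"
begin

section \<open>Unital C*-algebras\<close>

text \<open>The class \<open>real_normed_algebra_1\<close> includes \<open>norm 1 = 1\<close>, so the zero algebra (which has no
  states) is excluded.\<close>

class unital_cstar_algebra = real_normed_algebra_1 + complete_space +
  fixes scaleC :: "complex \<Rightarrow> 'a \<Rightarrow> 'a" (infixr "*\<^sub>C" 75)
    and star :: "'a \<Rightarrow> 'a"
  assumes scaleC_add_right: "c *\<^sub>C (a + b) = c *\<^sub>C a + c *\<^sub>C b"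
    and scaleC_add_left: "(c + d) *\<^sub>C a = c *\<^sub>C a + d *\<^sub>C a"
    and scaleC_scaleC: "c *\<^sub>C d *\<^sub>C a = (c * d) *\<^sub>C a"
    and scaleC_of_real: "complex_of_real r *\<^sub>C a = r *\<^sub>R a"
    and mult_scaleC_left: "(c *\<^sub>C a) * b = c *\<^sub>C (a * b)"
    and mult_scaleC_right: "a * (c *\<^sub>C b) = c *\<^sub>C (a * b)"
    and norm_scaleC: "norm (c *\<^sub>C a) = cmod c * norm a"
    and star_star: "star (star a) = a"
    and star_add: "star (a + b) = star a + star b"
    and star_scaleC: "star (c *\<^sub>C a) = cnj c *\<^sub>C star a"
    and star_mult: "star (a * b) = star b * star a"
    and cstar_identity: "norm (star a * a) = (norm a)\<^sup>2"

definition positive :: "'a::unital_cstar_algebra \<Rightarrow> bool" where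
  "positive a \<longleftrightarrow> (\<exists>b. a = star b * b)"

definition tracial_states :: "('a::unital_cstar_algebra \<Rightarrow> complex) set" where
  "tracial_states = {\<tau>.
     (\<forall>a b. \<tau> (a + b) = \<tau> a + \<tau> b) \<and>
     (\<forall>c a. \<tau> (c *\<^sub>C a) = c * \<tau> a) \<and>
     (\<forall>a. positive a \<longrightarrow> \<tau> a \<in> \<real>\<^sub>\<ge>\<^sub>0) \<and>
     \<tau> 1 = 1 \<and>
     (\<forall>a b. \<tau> (a * b) = \<tau> (b * a))}"

definition cstar_automorphism :: "('a::unital_cstar_algebra \<Rightarrow> 'a) \<Rightarrow> bool" where
  "cstar_automorphism \<phi> \<longleftrightarrow> bij \<phi> \<and>
     (\<forall>a b. \<phi> (a + b) = \<phi> a + \<phi> b) \<and>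
     (\<forall>c a. \<phi> (c *\<^sub>C a) = c *\<^sub>C \<phi> a) \<and>
     (\<forall>a b. \<phi> (a * b) = \<phi> a * \<phi> b) \<and>
     (\<forall>a. \<phi> (star a) = star (\<phi> a))"

definition group_action :: "('g::group_add \<Rightarrow> 'a::unital_cstar_algebra \<Rightarrow> 'a) \<Rightarrow> bool" where
  "group_action \<alpha> \<longleftrightarrow>
     (\<forall>v. cstar_automorphism (\<alpha> v)) \<and> (\<forall>v w. \<alpha> (v + w) = \<alpha> v \<circ> \<alpha> w)"

definition invariant_traces :: "('a::unital_cstar_algebra \<Rightarrow> 'a) \<Rightarrow> ('a \<Rightarrow> complex) set" where
  "invariant_traces \<phi> = {\<tau> \<in> tracial_states. \<forall>a. \<tau> (\<phi> a) = \<tau> a}"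


section \<open>Operators on a Hilbert space\<close>

text \<open>The GNS space depends on the trace, so it cannot be a type; Hilbert spaces are carrier sets
  with operations.  The inner product is linear in its first argument.\<close>

record 'h hspace =
  hcarrier :: "'h set"
  hadd :: "'h \<Rightarrow> 'h \<Rightarrow> 'h"
  hscale :: "complex \<Rightarrow> 'h \<Rightarrow> 'h"
  hinner :: "'h \<Rightarrow> 'h \<Rightarrow> complex"

definition hnorm :: "'h hspace \<Rightarrow> 'h \<Rightarrow> real" where
  "hnorm H x = sqrt (Re (hinner H x x))"

text \<open>Operators are extensional (\<open>undefined\<close> off the carrier), so that equality of operators is
  equality of functions.\<close>

definition bounded_ops :: "'h hspace \<Rightarrow> ('h \<Rightarrow> 'h) set" where
  "bounded_ops H = {T \<in> hcarrier H \<rightarrow>\<^sub>E hcarrier H.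
     (\<forall>x\<in>hcarrier H. \<forall>y\<in>hcarrier H. T (hadd H x y) = hadd H (T x) (T y)) \<and>
     (\<forall>c. \<forall>x\<in>hcarrier H. T (hscale H c x) = hscale H c (T x)) \<and>
     (\<exists>K. \<forall>x\<in>hcarrier H. hnorm H (T x) \<le> K * hnorm H x)}"

definition op_id :: "'h hspace \<Rightarrow> 'h \<Rightarrow> 'h" where
  "op_id H = (\<lambda>x\<in>hcarrier H. x)"

definition op_add :: "'h hspace \<Rightarrow> ('h \<Rightarrow> 'h) \<Rightarrow> ('h \<Rightarrow> 'h) \<Rightarrow> 'h \<Rightarrow> 'h" where
  "op_add H S T = (\<lambda>x\<in>hcarrier H. hadd H (S x) (T x))"

definition op_scale :: "'h hspace \<Rightarrow> complex \<Rightarrow> ('h \<Rightarrow> 'h) \<Rightarrow> 'h \<Rightarrow> 'h" where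
  "op_scale H c T = (\<lambda>x\<in>hcarrier H. hscale H c (T x))"

definition op_mult :: "'h hspace \<Rightarrow> ('h \<Rightarrow> 'h) \<Rightarrow> ('h \<Rightarrow> 'h) \<Rightarrow> 'h \<Rightarrow> 'h" where
  "op_mult H S T = (\<lambda>x\<in>hcarrier H. S (T x))"

text \<open>\<open>is_adjoint H T S\<close> says that \<open>S = T\<^sup>*\<close>.\<close>

definition is_adjoint :: "'h hspace \<Rightarrow> ('h \<Rightarrow> 'h) \<Rightarrow> ('h \<Rightarrow> 'h) \<Rightarrow> bool" where
  "is_adjoint H T S \<longleftrightarrow> T \<in> bounded_ops H \<and> S \<in> bounded_ops H \<and>
     (\<forall>x\<in>hcarrier H. \<forall>y\<in>hcarrier H. hinner H (T x) y = hinner H x (S y))"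

definition commutant :: "'h hspace \<Rightarrow> ('h \<Rightarrow> 'h) set \<Rightarrow> ('h \<Rightarrow> 'h) set" where
  "commutant H \<S> = {T \<in> bounded_ops H. \<forall>S\<in>\<S>. op_mult H T S = op_mult H S T}"

definition star_automorphism_on ::
  "'h hspace \<Rightarrow> ('h \<Rightarrow> 'h) set \<Rightarrow> (('h \<Rightarrow> 'h) \<Rightarrow> ('h \<Rightarrow> 'h)) \<Rightarrow> bool" where
  "star_automorphism_on H M \<theta> \<longleftrightarrow> bij_betw \<theta> M M \<and>
     (\<forall>S\<in>M. \<forall>T\<in>M. \<theta> (op_add H S T) = op_add H (\<theta> S) (\<theta> T)) \<and>
     (\<forall>c. \<forall>T\<in>M. \<theta> (op_scale H c T) = op_scale H c (\<theta> T)) \<and>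
     (\<forall>S\<in>M. \<forall>T\<in>M. \<theta> (op_mult H S T) = op_mult H (\<theta> S) (\<theta> T)) \<and>
     (\<forall>S\<in>M. \<forall>T\<in>M. is_adjoint H T S \<longrightarrow> is_adjoint H (\<theta> T) (\<theta> S))"

text \<open>In \<open>inner_on\<close>, \<open>V = W\<^sup>*\<close>, and \<open>\<theta>\<close> is \<open>Ad W\<close> on \<open>M\<close>.\<close>

definition inner_on ::
  "'h hspace \<Rightarrow> ('h \<Rightarrow> 'h) set \<Rightarrow> (('h \<Rightarrow> 'h) \<Rightarrow> ('h \<Rightarrow> 'h)) \<Rightarrow> bool" where
  "inner_on H M \<theta> \<longleftrightarrow> (\<exists>W\<in>M. \<exists>V\<in>M. is_adjoint H W V \<and>
     op_mult H W V = op_id H \<and> op_mult H V W = op_id H \<and>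
     (\<forall>T\<in>M. \<theta> T = op_mult H W (op_mult H T V)))"


section \<open>The GNS representation of a trace\<close>

definition trace_inner :: "('a::unital_cstar_algebra \<Rightarrow> complex) \<Rightarrow> 'a \<Rightarrow> 'a \<Rightarrow> complex" where
  "trace_inner \<tau> a b = \<tau> (star b * a)"

definition trace_norm :: "('a::unital_cstar_algebra \<Rightarrow> complex) \<Rightarrow> 'a \<Rightarrow> real" where
  "trace_norm \<tau> a = sqrt (Re (trace_inner \<tau> a a))"

text \<open>The GNS space is the completion of \<open>A\<close> modulo \<open>{a. \<tau> (star a * a) = 0}\<close>, built in one step as
  the Cauchy sequences for the seminorm \<open>trace_norm \<tau>\<close> modulo those of distance tending to \<open>0\<close>.\<close>

definition gns_cauchy :: "('a::unital_cstar_algebra \<Rightarrow> complex) \<Rightarrow> (nat \<Rightarrow> 'a) set" where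
  "gns_cauchy \<tau> = {X. \<forall>e>0. \<exists>N. \<forall>m\<ge>N. \<forall>n\<ge>N. trace_norm \<tau> (X m - X n) < e}"

definition gns_rel ::
  "('a::unital_cstar_algebra \<Rightarrow> complex) \<Rightarrow> ((nat \<Rightarrow> 'a) \<times> (nat \<Rightarrow> 'a)) set" where
  "gns_rel \<tau> = {(X, Y). X \<in> gns_cauchy \<tau> \<and> Y \<in> gns_cauchy \<tau> \<and>
     (\<lambda>n. trace_norm \<tau> (X n - Y n)) \<longlonglongrightarrow> 0}"

definition gns_space :: "('a::unital_cstar_algebra \<Rightarrow> complex) \<Rightarrow> (nat \<Rightarrow> 'a) set hspace" where
  "gns_space \<tau> = \<lparr>
     hcarrier = gns_cauchy \<tau> // gns_rel \<tau>,
     hadd = (\<lambda>p q. \<Union>X\<in>p. \<Union>Y\<in>q. gns_rel \<tau> `` {\<lambda>n. X n + Y n}),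
     hscale = (\<lambda>c p. \<Union>X\<in>p. gns_rel \<tau> `` {\<lambda>n. c *\<^sub>C X n}),
     hinner = (\<lambda>p q. THE c. \<forall>X\<in>p. \<forall>Y\<in>q. (\<lambda>n. trace_inner \<tau> (X n) (Y n)) \<longlonglongrightarrow> c)\<rparr>"

definition gns_rep ::
  "('a::unital_cstar_algebra \<Rightarrow> complex) \<Rightarrow> 'a \<Rightarrow> (nat \<Rightarrow> 'a) set \<Rightarrow> (nat \<Rightarrow> 'a) set" where
  "gns_rep \<tau> a = (\<lambda>p\<in>hcarrier (gns_space \<tau>). \<Union>X\<in>p. gns_rel \<tau> `` {\<lambda>n. a * X n})"

definition gns_vn_algebra ::
  "('a::unital_cstar_algebra \<Rightarrow> complex) \<Rightarrow> ((nat \<Rightarrow> 'a) set \<Rightarrow> (nat \<Rightarrow> 'a) set) set" where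
  "gns_vn_algebra \<tau> = commutant (gns_space \<tau>) (commutant (gns_space \<tau>) (range (gns_rep \<tau>)))"

definition gns_extension ::
  "('a::unital_cstar_algebra \<Rightarrow> complex) \<Rightarrow> ('a \<Rightarrow> 'a) \<Rightarrow>
    (((nat \<Rightarrow> 'a) set \<Rightarrow> (nat \<Rightarrow> 'a) set) \<Rightarrow> ((nat \<Rightarrow> 'a) set \<Rightarrow> (nat \<Rightarrow> 'a) set)) \<Rightarrow> bool" where
  "gns_extension \<tau> \<phi> \<theta> \<longleftrightarrow>
     star_automorphism_on (gns_space \<tau>) (gns_vn_algebra \<tau>) \<theta> \<and>
     (\<forall>a. \<theta> (gns_rep \<tau> a) = gns_rep \<tau> (\<phi> a))"

text \<open>For an invariant trace the extension exists, and it is unique because automorphisms of von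
  Neumann algebras are normal.  Existence is stated so that the second conjunct is not vacuous.\<close>

definition strongly_outer ::
  "('g::group_add \<Rightarrow> 'a::unital_cstar_algebra \<Rightarrow> 'a) \<Rightarrow> bool" where
  "strongly_outer \<alpha> \<longleftrightarrow> (\<forall>v. v \<noteq> 0 \<longrightarrow> (\<forall>\<tau>\<in>invariant_traces (\<alpha> v).
     (\<exists>\<theta>. gns_extension \<tau> (\<alpha> v) \<theta>) \<and>
     (\<forall>\<theta>. gns_extension \<tau> (\<alpha> v) \<theta> \<longrightarrow> \<not> inner_on (gns_space \<tau>) (gns_vn_algebra \<tau>) \<theta>)))"


section \<open>Rokhlin dimension\<close>

definition rok_box :: "nat \<Rightarrow> (int ^ 'm) set" where
  "rok_box n = {v. \<forall>i. 0 \<le> v $ i \<and> v $ i < int n}"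

definition rok_mod :: "nat \<Rightarrow> int ^ 'm \<Rightarrow> int ^ 'm" where
  "rok_mod n v = (\<chi> i. v $ i mod int n)"

text \<open>The towers are indexed by \<open>n \<ge> 1\<close>: for \<open>n = 0\<close> the box is empty and the last condition could
  never hold.\<close>

definition dim_rok_le :: "(int ^ 'm \<Rightarrow> 'a::unital_cstar_algebra \<Rightarrow> 'a) \<Rightarrow> nat \<Rightarrow> bool" where
  "dim_rok_le \<alpha> d \<longleftrightarrow> (\<forall>F \<epsilon> n. finite F \<longrightarrow> \<epsilon> > (0::real) \<longrightarrow> n \<ge> 1 \<longrightarrow>
     (\<exists>f :: nat \<Rightarrow> int ^ 'm \<Rightarrow> 'a.
       (\<forall>l\<le>d. \<forall>v\<in>rok_box n. positive (f l v) \<and> norm (f l v) \<le> 1) \<and>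
       (\<forall>l\<le>d. \<forall>v\<in>rok_box n. \<forall>w. norm (\<alpha> w (f l v) - f l (rok_mod n (v + w))) < \<epsilon>) \<and>
       (\<forall>l\<le>d. \<forall>v\<in>rok_box n. \<forall>v'\<in>rok_box n. v \<noteq> v' \<longrightarrow> norm (f l v * f l v') < \<epsilon>) \<and>
       (\<forall>l\<le>d. \<forall>v\<in>rok_box n. \<forall>a\<in>F. norm (f l v * a - a * f l v) < \<epsilon>) \<and>
       norm ((\<Sum>l\<le>d. \<Sum>v\<in>rok_box n. f l v) - 1) < \<epsilon>))"

definition dim_rok :: "(int ^ 'm \<Rightarrow> 'a::unital_cstar_algebra \<Rightarrow> 'a) \<Rightarrow> enat" where
  "dim_rok \<alpha> = (INF d \<in> {d. dim_rok_le \<alpha> d}. enat d)"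

end

theory Submission
  imports Defs
begin

text \<open>
  Write \<open>\<parallel>x\<parallel>\<^sub>2 = \<tau>(x\<^sup>*x)\<^bsup>1/2\<^esup>\<close>, let \<open>\<phi> = \<alpha>\<^sup>v\<close> with \<open>v \<noteq> 0\<close>, let \<open>\<tau>\<close> be \<open>\<phi>\<close>-invariant, and let \<open>\<xi>\<close> be the
  class of \<open>1\<close> in the GNS space.  Two things have to be shown: \<open>\<phi>\<close> extends to the von Neumann
  algebra, and no extension is inner.

  Existence.  Invariance makes \<open>[x] \<mapsto> [\<phi> x]\<close> a unitary \<open>U\<close> with \<open>U \<pi>(a) U\<^sup>* = \<pi>(\<phi> a)\<close>.
  Conjugation by \<open>U\<close> permutes \<open>\<pi>(A)\<close>, hence preserves its commutant and its bicommutant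
  (\<open>conjugate_commutant\<close>), where it is the required extension (\<open>gns_extension_exists\<close>).

  Outerness.  Suppose that the extension is \<open>Ad W\<close>, so that \<open>\<pi>(\<phi> a) W = W \<pi>(a)\<close>.  Apply both
  sides to \<open>\<xi>\<close>.  On \<open>\<xi>\<close>, left multiplication by \<open>a\<close> agrees with right multiplication by \<open>a\<close>,
  which is bounded because \<open>\<tau>\<close> is a trace and commutes with \<open>W\<close> because \<open>W\<close> is in the
  bicommutant.  If \<open>x \<in> A\<close> approximates \<open>W \<xi>\<close>, then \<open>\<phi>(a) x \<approx> x a\<close> in \<open>\<parallel>\<cdot>\<parallel>\<^sub>2\<close>, uniformly over
  contractions \<open>a\<close> (\<open>inner_extension_imp_almost_intertwiner\<close>).  Take Rokhlin towers that almost
  commute with this single element \<open>x\<close>, over a box \<open>B\<^sub>n\<close> so large that \<open>u\<close> and \<open>u + v\<close> never agree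
  modulo \<open>n\<close>.  Then \<open>f\<^bsub>u+v\<^esub> x \<approx> \<phi>(f\<^sub>u) x \<approx> x f\<^sub>u \<approx> f\<^sub>u x\<close>.  But \<open>f\<^sub>u\<close> and \<open>f\<^bsub>u+v\<^esub>\<close> are almost
  orthogonal, so the vectors \<open>f\<^bsub>u+v\<^esub> x\<close> and \<open>f\<^sub>u x\<close> are almost orthogonal as well as almost equal:
  both are small (\<open>shifted_element_small\<close>).  The number of tower elements depends only on \<open>d\<close> and
  \<open>n\<close>, and they almost add up to \<open>1\<close>, so \<open>x\<close> is small too, against \<open>\<parallel>W \<xi>\<parallel> = \<parallel>\<xi>\<parallel> = 1\<close>.

  All estimates rest on \<open>\<parallel>a x\<parallel>\<^sub>2 \<le> \<parallel>a\<parallel> \<parallel>x\<parallel>\<^sub>2\<close> (\<open>nrm_mult_left\<close>), that is, on the positivity of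
  \<open>K\<^sup>2 - a\<^sup>*a\<close> for \<open>K > \<parallel>a\<parallel>\<close>; the square root that witnesses it is a binomial series.
\<close>


section \<open>Square roots\<close>

instance unital_cstar_algebra \<subseteq> banach ..

lemma star_zero [simp]: "star (0::'a::unital_cstar_algebra) = 0"
  using star_add [of "0::'a" 0] by simp

lemma star_minus: "star (- a) = - star (a::'a::unital_cstar_algebra)"
  using star_add [of a "- a"] by (simp add: eq_neg_iff_add_eq_0 add.commute)

lemma star_diff: "star (a - b) = star a - star (b::'a::unital_cstar_algebra)"
  using star_add [of a "- b"] by (simp add: star_minus)

lemma star_one [simp]: "star (1::'a::unital_cstar_algebra) = 1"
  using star_mult [of "star (1::'a)" 1] by (simp add: star_star)

lemma star_scaleR: "star (r *\<^sub>R a) = r *\<^sub>R star (a::'a::unital_cstar_algebra)"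
  using star_scaleC [of "complex_of_real r" a] by (simp add: scaleC_of_real)

lemma star_power: "star (a ^ n) = star (a::'a::unital_cstar_algebra) ^ n"
  by (induction n) (simp_all add: star_mult power_commutes)

lemma norm_star: "norm (star a) = norm (a::'a::unital_cstar_algebra)"
proof -
  have *: "norm b \<le> norm (star b)" for b :: 'a
  proof (cases "b = 0")
    case False
    have "norm b * norm b \<le> norm (star b) * norm b"
      using norm_mult_ineq [of "star b" b] by (simp add: cstar_identity power2_eq_square)
    with False show ?thesis by simp
  qed simp
  show ?thesis using * [of a] * [of "star a"] by (simp add: star_star)
qed

lemma bounded_linear_star: "bounded_linear (star :: 'a::unital_cstar_algebra \<Rightarrow> 'a)"
  by (rule bounded_linear_intro [where K = 1]) (simp_all add: star_add star_scaleR norm_star)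

lemma positive_imp_selfadjoint: "positive a \<Longrightarrow> star a = a"
  by (auto simp: positive_def star_mult star_star)

lemma abs_half_gbinomial_le_1: "\<bar>(1/2::real) gchoose n\<bar> \<le> 1"
proof (induction n)
  case (Suc n)
  have "(1/2 gchoose Suc n) = (1/2 gchoose n) * ((1/2 - real n) / real (Suc n))"
    by (simp add: gbinomial_prod_rev field_simps prod.atLeast0_lessThan_Suc)
  moreover have "\<bar>(1/2 - real n) / real (Suc n)\<bar> \<le> 1"
    by (simp add: abs_if field_simps)
  ultimately show ?case
    using Suc by (simp only: abs_mult) (intro mult_le_one, auto)
qed simp

text \<open>The root is \<open>\<Sum>\<^sub>n (1/2 gchoose n) (-x)\<^sup>n\<close>.  The coefficients are bounded by \<open>1\<close>, so the series
  converges absolutely like a geometric one; Vandermonde's convolution identity turns its square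
  into the binomial series with exponent \<open>1/2 + 1/2 = 1\<close>, which is \<open>1 - x\<close>.\<close>

lemma selfadjoint_sqrt_one_minus:
  fixes x :: "'a::unital_cstar_algebra"
  assumes sa: "star x = x" and small: "norm x < 1"
  obtains c where "star c = c" "c * c = 1 - x"
proof -
  define g where "g n = ((1/2::real) gchoose n) *\<^sub>R (- x) ^ n" for n
  have le: "norm (g n) \<le> norm x ^ n" for n
  proof -
    have "norm (g n) \<le> 1 * norm (- x) ^ n"
      unfolding g_def norm_scaleR
      by (intro mult_mono norm_power_ineq abs_half_gbinomial_le_1) auto
    thus ?thesis by simp
  qed
  have sn: "summable (\<lambda>n. norm (g n))"
    by (rule summable_comparison_test' [where N = 0 and g = "\<lambda>n. norm x ^ n"])
       (use le small in \<open>auto intro: summable_geometric\<close>)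
  have star_g: "star (g n) = g n" for n
    by (simp add: g_def star_scaleR star_power star_minus sa)
  have "(\<lambda>n. star (g n)) sums star (suminf g)"
    by (rule bounded_linear.sums [OF bounded_linear_star summable_sums])
       (rule summable_norm_cancel [OF sn])
  hence "star (suminf g) = suminf g"
    by (simp add: star_g sums_iff)
  moreover have "suminf g * suminf g = 1 - x"
  proof -
    have "(\<Sum>i\<le>k. g i * g (k - i)) = ((1::real) gchoose k) *\<^sub>R (- x) ^ k" for k
    proof -
      have "(\<Sum>i\<le>k. g i * g (k - i))
          = (\<Sum>i\<le>k. ((1/2 gchoose i) * (1/2 gchoose (k - i))) *\<^sub>R (- x) ^ k)"
        by (rule sum.cong) (auto simp: g_def mult.commute simp flip: power_add)
      also have "\<dots> = ((1/2 + 1/2 :: real) gchoose k) *\<^sub>R (- x) ^ k"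
        by (simp only: gbinomial_Vandermonde [of _ _ k, symmetric] scaleR_left.sum atMost_atLeast0)
      finally show ?thesis by simp
    qed
    hence "(\<lambda>k. ((1::real) gchoose k) *\<^sub>R (- x) ^ k) sums (suminf g * suminf g)"
      using Cauchy_product_sums [OF sn sn] by simp
    moreover have "(\<lambda>k. ((1::real) gchoose k) *\<^sub>R (- x) ^ k) sums
        (\<Sum>k\<in>{0,1}. ((1::real) gchoose k) *\<^sub>R (- x) ^ k)"
    proof (rule sums_finite)
      fix k :: nat assume "k \<notin> {0,1}"
      hence "real (1 choose k) = 0" by simp
      hence "((1::real) gchoose k) = 0" by (simp only: binomial_gbinomial of_nat_1)
      thus "((1::real) gchoose k) *\<^sub>R (- x) ^ k = 0" by simp
    qed simp
    ultimately show ?thesis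
      by (auto dest: sums_unique2)
  qed
  ultimately show thesis by (rule that)
qed

lemma norm_bound_minus_square_positive:
  fixes a :: "'a::unital_cstar_algebra"
  assumes "norm a < K"
  obtains c where "star c * c = (K\<^sup>2) *\<^sub>R 1 - star a * a"
proof -
  have K: "K > 0" using assms norm_ge_zero [of a] by linarith
  have "norm ((1 / K\<^sup>2) *\<^sub>R (star a * a)) < 1"
    using assms K by (simp add: cstar_identity field_simps power_strict_mono)
  moreover have "star ((1 / K\<^sup>2) *\<^sub>R (star a * a)) = (1 / K\<^sup>2) *\<^sub>R (star a * a)"
    by (simp add: star_scaleR star_mult star_star)
  ultimately obtain c where c: "star c = c" "c * c = 1 - (1 / K\<^sup>2) *\<^sub>R (star a * a)"
    using selfadjoint_sqrt_one_minus by blast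
  have "star (K *\<^sub>R c) * (K *\<^sub>R c) = (K\<^sup>2) *\<^sub>R (c * c)"
    by (simp add: star_scaleR c power2_eq_square)
  also have "\<dots> = (K\<^sup>2) *\<^sub>R 1 - star a * a"
    using K by (simp add: c scaleR_diff_right)
  finally show thesis by (rule that)
qed


section \<open>The seminorm of a trace\<close>

locale trace =
  fixes \<tau> :: "'a::unital_cstar_algebra \<Rightarrow> complex"
  assumes tracial_state: "\<tau> \<in> tracial_states"
begin

abbreviation inn where "inn \<equiv> trace_inner \<tau>"
abbreviation nrm where "nrm \<equiv> trace_norm \<tau>"

lemma trace_add: "\<tau> (a + b) = \<tau> a + \<tau> b"
  and trace_scaleC: "\<tau> (c *\<^sub>C a) = c * \<tau> a"
  and trace_one: "\<tau> 1 = 1"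
  and trace_commute: "\<tau> (a * b) = \<tau> (b * a)"
  and trace_square: "\<tau> (star b * b) \<in> \<real>\<^sub>\<ge>\<^sub>0"
  using tracial_state by (auto simp: tracial_states_def positive_def)

lemma trace_diff: "\<tau> (a - b) = \<tau> a - \<tau> b"
  using trace_add [of "a - b" b] by simp

lemma trace_scaleR: "\<tau> (r *\<^sub>R a) = of_real r * \<tau> a"
  using trace_scaleC [of "of_real r" a] by (simp add: scaleC_of_real)

lemma inn_simps:
  "inn (x + y) z = inn x z + inn y z" "inn z (x + y) = inn z x + inn z y"
  "inn (x - y) z = inn x z - inn y z" "inn z (x - y) = inn z x - inn z y"
  "inn (c *\<^sub>C x) z = c * inn x z" "inn z (c *\<^sub>C x) = cnj c * inn z x"
  by (simp_all add: trace_inner_def trace_add trace_diff trace_scaleC star_add star_diff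
      star_scaleC algebra_simps mult_scaleC_left mult_scaleC_right)

lemma Re_inn_self: "Re (inn x x) \<ge> 0" and Im_inn_self: "Im (inn x x) = 0"
  using trace_square [of x] by (simp_all add: trace_inner_def complex_nonneg_Reals_iff)

lemma nrm_square: "(nrm x)\<^sup>2 = Re (inn x x)"
  by (simp add: trace_norm_def Re_inn_self)

lemma nrm_nonneg [simp]: "nrm x \<ge> 0"
  by (simp add: trace_norm_def Re_inn_self)

lemma inn_commute: "inn y x = cnj (inn x y)"
proof -
  have "Im (inn x y + inn y x) = 0"
    using Im_inn_self [of "x + y"] Im_inn_self [of x] Im_inn_self [of y] by (simp add: inn_simps)
  moreover have "Re (inn y x) - Re (inn x y) = 0"
    using Im_inn_self [of "x + \<i> *\<^sub>C y"] Im_inn_self [of x] Im_inn_self [of y]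
    by (simp add: inn_simps)
  ultimately show ?thesis by (simp add: complex_eq_iff)
qed

lemma nrm_add_square: "(nrm (x + y))\<^sup>2 = (nrm x)\<^sup>2 + 2 * Re (inn x y) + (nrm y)\<^sup>2"
  using inn_commute [of x y] by (simp add: nrm_square inn_simps)

lemma nrm_diff_square: "(nrm (x - y))\<^sup>2 = (nrm x)\<^sup>2 - 2 * Re (inn x y) + (nrm y)\<^sup>2"
  using inn_commute [of x y] by (simp add: nrm_square inn_simps)

lemma nrm_scaleC: "nrm (c *\<^sub>C x) = cmod c * nrm x"
proof -
  have "inn (c *\<^sub>C x) (c *\<^sub>C x) = of_real ((cmod c)\<^sup>2) * inn x x"
    by (simp only: inn_simps complex_norm_square mult_ac)
  hence "Re (inn (c *\<^sub>C x) (c *\<^sub>C x)) = (cmod c)\<^sup>2 * Re (inn x x)"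
    by (simp only: Re_complex_of_real times_complex.simps) simp
  thus ?thesis by (simp add: trace_norm_def real_sqrt_mult)
qed

text \<open>The form may be degenerate, so dividing by \<open>nrm y\<close> needs care: with \<open>c = t \<sqdot> inn x y\<close>, the
  inequality \<open>0 \<le> (nrm (x - c y))\<^sup>2\<close> is a quadratic one in the real parameter \<open>t\<close>.  If \<open>nrm y = 0\<close>, it
  is affine in \<open>t\<close> and fails for large \<open>t\<close> unless \<open>inn x y = 0\<close>; otherwise \<open>t = 1 / (nrm y)\<^sup>2\<close> is
  optimal.\<close>

lemma Cauchy_Schwarz: "cmod (inn x y) \<le> nrm x * nrm y"
proof (cases "inn x y = 0")
  case False
  define m where "m = cmod (inn x y)"
  have m: "m > 0" using False by (simp add: m_def)
  have quad: "0 \<le> (nrm x)\<^sup>2 - 2 * t * m\<^sup>2 + t\<^sup>2 * m\<^sup>2 * (nrm y)\<^sup>2" for t :: real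
  proof -
    let ?c = "of_real t * inn x y"
    have "inn x (?c *\<^sub>C y) = of_real (t * m\<^sup>2)"
      by (simp only: inn_simps m_def complex_norm_square of_real_mult complex_cnj_mult complex_cnj_complex_of_real mult_ac)
    hence "(nrm (x - ?c *\<^sub>C y))\<^sup>2 = (nrm x)\<^sup>2 - 2 * (t * m\<^sup>2) + (nrm (?c *\<^sub>C y))\<^sup>2"
      by (simp only: nrm_diff_square Re_complex_of_real)
    also have "(nrm (?c *\<^sub>C y))\<^sup>2 = t\<^sup>2 * m\<^sup>2 * (nrm y)\<^sup>2"
      by (simp add: nrm_scaleC norm_mult power_mult_distrib m_def)
    finally show ?thesis
      using zero_le_power2 [of "nrm (x - ?c *\<^sub>C y)"] by simp
  qed
  have "nrm y \<noteq> 0"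
  proof
    assume "nrm y = 0"
    hence "0 \<le> (nrm x)\<^sup>2 - 2 * (((nrm x)\<^sup>2 + 1) / (2 * m\<^sup>2)) * m\<^sup>2"
      using quad [of "((nrm x)\<^sup>2 + 1) / (2 * m\<^sup>2)"] by simp
    with m show False by simp
  qed
  moreover from this have "m\<^sup>2 \<le> (nrm x)\<^sup>2 * (nrm y)\<^sup>2"
    using quad [of "1 / (nrm y)\<^sup>2"] by (simp add: power2_eq_square divide_simps split: if_splits)
  ultimately show ?thesis
    by (metis m_def mult_nonneg_nonneg nrm_nonneg power2_le_imp_le power_mult_distrib)
qed simp

lemma nrm_triangle: "nrm (x + y) \<le> nrm x + nrm y"
proof (rule power2_le_imp_le)
  have "Re (inn x y) \<le> nrm x * nrm y"
    using Cauchy_Schwarz [of x y] complex_Re_le_cmod [of "inn x y"] by linarith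
  thus "(nrm (x + y))\<^sup>2 \<le> (nrm x + nrm y)\<^sup>2"
    by (simp add: nrm_add_square power2_sum)
qed simp

lemma nrm_zero [simp]: "nrm 0 = 0"
  using nrm_scaleC [of 0 0] scaleC_of_real [of 0 "0::'a"] by simp

lemma nrm_minus: "nrm (- x) = nrm x"
  using nrm_scaleC [of "-1" x] scaleC_of_real [of "-1" x] by simp

lemma nrm_minus_commute: "nrm (x - y) = nrm (y - x)"
  using nrm_minus [of "x - y"] by simp

lemma nrm_triangle_diff: "nrm (x - z) \<le> nrm (x - y) + nrm (y - z)"
  using nrm_triangle [of "x - y" "y - z"] by simp

lemma nrm_reverse_triangle: "\<bar>nrm x - nrm y\<bar> \<le> nrm (x - y)"
  using nrm_triangle [of "x - y" y] nrm_triangle [of "y - x" x] nrm_minus_commute [of x y] by simp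

lemma nrm_sum_le: "nrm (sum g I) \<le> (\<Sum>i\<in>I. nrm (g i))"
  by (induction I rule: infinite_finite_induct) (auto intro: order.trans [OF nrm_triangle])

text \<open>If \<open>K > norm a\<close>, then \<open>K\<^sup>2 - a\<^sup>* a = c\<^sup>* c\<close>, and applying \<open>\<tau>\<close> to \<open>(c x)\<^sup>* (c x)\<close> gives the
  inequality with \<open>K\<close> in place of \<open>norm a\<close>.\<close>

lemma nrm_mult_left: "nrm (a * x) \<le> norm a * nrm x"
proof (rule field_le_epsilon)
  fix e :: real assume e: "e > 0"
  define K where "K = norm a + e / (nrm x + 1)"
  have pos: "nrm x + 1 > 0" using nrm_nonneg [of x] by linarith
  have "norm a < K" using e pos by (simp add: K_def)
  then obtain c where c: "star c * c = (K\<^sup>2) *\<^sub>R 1 - star a * a"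
    by (rule norm_bound_minus_square_positive)
  have "star (c * x) * (c * x) = star x * (star c * c) * x"
    by (simp add: star_mult mult.assoc)
  also have "\<dots> = (K\<^sup>2) *\<^sub>R (star x * x) - star (a * x) * (a * x)"
    by (simp add: c star_mult algebra_simps)
  finally have "inn (c * x) (c * x) = of_real (K\<^sup>2) * inn x x - inn (a * x) (a * x)"
    by (simp add: trace_inner_def trace_diff trace_scaleR)
  hence "Re (inn (c * x) (c * x)) = K\<^sup>2 * Re (inn x x) - Re (inn (a * x) (a * x))"
    by (simp only: minus_complex.simps Re_complex_of_real Im_complex_of_real times_complex.simps)
  hence "(nrm (a * x))\<^sup>2 \<le> (K * nrm x)\<^sup>2"
    using Re_inn_self [of "c * x"] by (simp add: power_mult_distrib nrm_square)
  hence "nrm (a * x) \<le> K * nrm x"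
    by (rule power2_le_imp_le) (use \<open>norm a < K\<close> norm_ge_zero [of a] in \<open>simp del: norm_ge_zero\<close>)
  also have "\<dots> = norm a * nrm x + e * (nrm x / (nrm x + 1))"
    by (simp add: K_def algebra_simps)
  also have "e * (nrm x / (nrm x + 1)) \<le> e"
    using e pos by (simp add: field_simps)
  finally show "nrm (a * x) \<le> norm a * nrm x + e" by simp
qed

text \<open>Because \<open>\<tau>\<close> is tracial, the involution is isometric for the seminorm; it turns the bound
  for left multiplications into one for right multiplications.\<close>

lemma nrm_star: "nrm (star x) = nrm x"
  using trace_commute [of x "star x"] by (simp add: trace_norm_def trace_inner_def star_star)

lemma nrm_mult_right: "nrm (x * a) \<le> norm a * nrm x"
  using nrm_mult_left [of "star a" "star x"] nrm_star [of "x * a"]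
  by (simp add: star_mult nrm_star norm_star)

lemma nrm_one: "nrm 1 = 1"
  by (simp add: trace_norm_def trace_inner_def trace_one)

lemma nrm_le_norm: "nrm a \<le> norm a"
  using nrm_mult_left [of a 1] by (simp add: nrm_one)


section \<open>The GNS space\<close>

abbreviation H where "H \<equiv> gns_space \<tau>"

lemma gns_cauchyD:
  assumes "X \<in> gns_cauchy \<tau>" "e > 0"
  obtains N where "\<And>m n. m \<ge> N \<Longrightarrow> n \<ge> N \<Longrightarrow> nrm (X m - X n) < e"
  using assms unfolding gns_cauchy_def by blast

text \<open>One criterion covers sums of two Cauchy sequences and images of one sequence under a bounded
  map; in the second case \<open>Y\<close> is constant.\<close>

lemma gns_cauchy_map2:
  assumes X: "X \<in> gns_cauchy \<tau>" and Y: "Y \<in> gns_cauchy \<tau>" and K: "K \<ge> 0"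
    and le: "\<And>m n. nrm (Z m - Z n) \<le> K * (nrm (X m - X n) + nrm (Y m - Y n))"
  shows "Z \<in> gns_cauchy \<tau>"
  unfolding gns_cauchy_def mem_Collect_eq
proof (intro allI impI)
  fix e :: real assume "e > 0"
  hence e: "e / (K + 1) / 2 > 0" using K by simp
  obtain M where M: "\<And>m n. m \<ge> M \<Longrightarrow> n \<ge> M \<Longrightarrow> nrm (X m - X n) < e / (K + 1) / 2"
    using gns_cauchyD [OF X e] by blast
  obtain N where N: "\<And>m n. m \<ge> N \<Longrightarrow> n \<ge> N \<Longrightarrow> nrm (Y m - Y n) < e / (K + 1) / 2"
    using gns_cauchyD [OF Y e] by blast
  have "nrm (Z m - Z n) < e" if "m \<ge> max M N" "n \<ge> max M N" for m n
  proof -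
    have "nrm (Z m - Z n) \<le> K * (nrm (X m - X n) + nrm (Y m - Y n))" by (rule le)
    also have "\<dots> \<le> (K + 1) * (nrm (X m - X n) + nrm (Y m - Y n))"
      by (intro mult_right_mono) auto
    also have "\<dots> < (K + 1) * (e / (K + 1) / 2 + e / (K + 1) / 2)"
      using M [of m n] N [of m n] that K by (intro mult_strict_left_mono add_strict_mono) auto
    also have "\<dots> = e" using K by (simp add: divide_eq_eq)
    finally show ?thesis .
  qed
  thus "\<exists>N. \<forall>m\<ge>N. \<forall>n\<ge>N. nrm (Z m - Z n) < e" by blast
qed

lemma gns_cauchy_const: "(\<lambda>_. a) \<in> gns_cauchy \<tau>"
  by (simp add: gns_cauchy_def)

lemma gns_cauchy_add:
  "X \<in> gns_cauchy \<tau> \<Longrightarrow> Y \<in> gns_cauchy \<tau> \<Longrightarrow> (\<lambda>n. X n + Y n) \<in> gns_cauchy \<tau>"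
  by (erule (1) gns_cauchy_map2 [where K = 1])
     (use nrm_triangle in \<open>auto simp: add_diff_add\<close>)

lemma gns_cauchy_scaleC: "X \<in> gns_cauchy \<tau> \<Longrightarrow> (\<lambda>n. c *\<^sub>C X n) \<in> gns_cauchy \<tau>"
proof (erule gns_cauchy_map2 [where K = "cmod c", OF _ gns_cauchy_const [of 0]])
  show "nrm (c *\<^sub>C X m - c *\<^sub>C X n) \<le> cmod c * (nrm (X m - X n) + nrm (0 - 0))" for m n
    using scaleC_add_right [of c "X m - X n" "X n"] nrm_scaleC [of c "X m - X n"]
    by (simp add: algebra_simps)
qed simp

lemma nrm_convergent:
  assumes "X \<in> gns_cauchy \<tau>"
  shows "convergent (\<lambda>n. nrm (X n))"
proof (rule real_Cauchy_convergent, rule metric_CauchyI)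
  fix e :: real assume "e > 0"
  then obtain N where N: "\<And>m n. m \<ge> N \<Longrightarrow> n \<ge> N \<Longrightarrow> nrm (X m - X n) < e"
    using gns_cauchyD [OF assms] by blast
  have "dist (nrm (X m)) (nrm (X n)) < e" if "m \<ge> N" "n \<ge> N" for m n
    using N [OF that] nrm_reverse_triangle [of "X m" "X n"] by (simp add: dist_real_def)
  thus "\<exists>M. \<forall>m\<ge>M. \<forall>n\<ge>M. dist (nrm (X m)) (nrm (X n)) < e" by blast
qed

lemma inn_polarization:
  "inn x y = (of_real ((nrm (x + y))\<^sup>2) - of_real ((nrm (x + (-1) *\<^sub>C y))\<^sup>2)
     + \<i> * (of_real ((nrm (x + \<i> *\<^sub>C y))\<^sup>2) - of_real ((nrm (x + (-\<i>) *\<^sub>C y))\<^sup>2))) / 4"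
  by (simp add: nrm_add_square nrm_scaleC inn_simps complex_eq_iff)

text \<open>By polarization, convergence of inner products reduces to that of norms.\<close>

lemma inn_convergent:
  assumes X: "X \<in> gns_cauchy \<tau>" and Y: "Y \<in> gns_cauchy \<tau>"
  shows "convergent (\<lambda>n. inn (X n) (Y n))"
proof -
  have "convergent (\<lambda>n. complex_of_real ((nrm (X n + c *\<^sub>C Y n))\<^sup>2))" for c
    using nrm_convergent [OF gns_cauchy_add [OF X gns_cauchy_scaleC [OF Y, of c]]]
    unfolding convergent_def by (metis tendsto_of_real tendsto_power)
  from this [of 1] this [of "-1"] this [of "\<i>"] this [of "-\<i>"]
  obtain a b c d where "(\<lambda>n. complex_of_real ((nrm (X n + 1 *\<^sub>C Y n))\<^sup>2)) \<longlonglongrightarrow> a"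
    "(\<lambda>n. complex_of_real ((nrm (X n + (-1) *\<^sub>C Y n))\<^sup>2)) \<longlonglongrightarrow> b"
    "(\<lambda>n. complex_of_real ((nrm (X n + \<i> *\<^sub>C Y n))\<^sup>2)) \<longlonglongrightarrow> c"
    "(\<lambda>n. complex_of_real ((nrm (X n + (-\<i>) *\<^sub>C Y n))\<^sup>2)) \<longlonglongrightarrow> d"
    unfolding convergent_def by blast
  moreover have "1 *\<^sub>C y = y" for y :: 'a using scaleC_of_real [of 1 y] by simp
  ultimately have "(\<lambda>n. inn (X n) (Y n)) \<longlonglongrightarrow> (a - b + \<i> * (c - d)) / 4"
    unfolding inn_polarization by (intro tendsto_intros) simp_all
  thus ?thesis by (rule convergentI)
qed

lemma gns_relD: "(X, Y) \<in> gns_rel \<tau> \<Longrightarrow> (\<lambda>n. nrm (X n - Y n)) \<longlonglongrightarrow> 0"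
  by (simp add: gns_rel_def)

lemma nrm_squeeze:
  assumes "B \<longlonglongrightarrow> 0" "\<And>n. nrm (Z n) \<le> B n"
  shows "(\<lambda>n. nrm (Z n)) \<longlonglongrightarrow> 0"
  using assms by (intro Lim_null_comparison [OF _ assms(1)]) (simp add: always_eventually)

lemma equiv_gns_rel: "equiv (gns_cauchy \<tau>) (gns_rel \<tau>)"
proof (rule equivI)
  show "gns_rel \<tau> \<subseteq> gns_cauchy \<tau> \<times> gns_cauchy \<tau>" by (auto simp: gns_rel_def)
  show "refl_on (gns_cauchy \<tau>) (gns_rel \<tau>)" by (auto simp: refl_on_def gns_rel_def)
  show "sym (gns_rel \<tau>)"
    by (rule symI) (auto simp: gns_rel_def nrm_minus_commute)
  show "trans (gns_rel \<tau>)"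
  proof (rule transI)
    fix X Y Z assume *: "(X, Y) \<in> gns_rel \<tau>" "(Y, Z) \<in> gns_rel \<tau>"
    have "(\<lambda>n. nrm (X n - Y n) + nrm (Y n - Z n)) \<longlonglongrightarrow> 0"
      using tendsto_add [OF gns_relD [OF *(1)] gns_relD [OF *(2)]] by simp
    hence "(\<lambda>n. nrm (X n - Z n)) \<longlonglongrightarrow> 0"
      by (rule nrm_squeeze) (rule nrm_triangle_diff)
    with * show "(X, Z) \<in> gns_rel \<tau>" by (simp add: gns_rel_def)
  qed
qed

lemma inn_diff_tendsto_0:
  assumes X: "(X, X') \<in> gns_rel \<tau>" and Y: "(Y, Y') \<in> gns_rel \<tau>"
  shows "(\<lambda>n. inn (X' n) (Y' n) - inn (X n) (Y n)) \<longlonglongrightarrow> 0"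
proof -
  have C: "X \<in> gns_cauchy \<tau>" "Y' \<in> gns_cauchy \<tau>" using assms by (auto simp: gns_rel_def)
  obtain a b where a: "(\<lambda>n. nrm (X n)) \<longlonglongrightarrow> a" and b: "(\<lambda>n. nrm (Y' n)) \<longlonglongrightarrow> b"
    using nrm_convergent [OF C(1)] nrm_convergent [OF C(2)] by (auto simp: convergent_def)
  have "(\<lambda>n. nrm (X n - X' n) * nrm (Y' n) + nrm (X n) * nrm (Y n - Y' n)) \<longlonglongrightarrow> 0 * b + a * 0"
    by (intro tendsto_intros gns_relD [OF X] gns_relD [OF Y] a b)
  hence lim: "(\<lambda>n. nrm (X n - X' n) * nrm (Y' n) + nrm (X n) * nrm (Y n - Y' n)) \<longlonglongrightarrow> 0"
    by simp
  have "norm (inn (X' n) (Y' n) - inn (X n) (Y n))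
      \<le> nrm (X n - X' n) * nrm (Y' n) + nrm (X n) * nrm (Y n - Y' n)" for n
  proof -
    have "inn (X' n) (Y' n) - inn (X n) (Y n) = inn (X' n - X n) (Y' n) + inn (X n) (Y' n - Y n)"
      by (simp add: inn_simps)
    also have "norm \<dots> \<le> nrm (X' n - X n) * nrm (Y' n) + nrm (X n) * nrm (Y' n - Y n)"
      by (intro norm_triangle_le add_mono Cauchy_Schwarz)
    finally show ?thesis by (simp add: nrm_minus_commute)
  qed
  thus ?thesis
    by (intro Lim_null_comparison [OF _ lim]) (simp add: always_eventually)
qed

abbreviation gns_class :: "(nat \<Rightarrow> 'a) \<Rightarrow> (nat \<Rightarrow> 'a) set"
  where "gns_class X \<equiv> gns_rel \<tau> `` {X}"

lemma gns_class_in_carrier: "X \<in> gns_cauchy \<tau> \<Longrightarrow> gns_class X \<in> hcarrier H"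
  by (simp add: gns_space_def quotientI)

lemma carrier_cases:
  assumes "p \<in> hcarrier H" obtains X where "X \<in> gns_cauchy \<tau>" "p = gns_class X"
  using assms by (auto simp: gns_space_def elim: quotientE)

lemma gns_class_eqI: "(X, Y) \<in> gns_rel \<tau> \<Longrightarrow> gns_class X = gns_class Y"
  by (rule equiv_class_eq [OF equiv_gns_rel])

lemma gns_class_eqD: "gns_class X = gns_class Y \<Longrightarrow> Y \<in> gns_cauchy \<tau> \<Longrightarrow> (X, Y) \<in> gns_rel \<tau>"
  by (rule eq_equiv_class [OF _ equiv_gns_rel])

lemma hadd_gns_class:
  assumes "X \<in> gns_cauchy \<tau>" "Y \<in> gns_cauchy \<tau>"
  shows "hadd H (gns_class X) (gns_class Y) = gns_class (\<lambda>n. X n + Y n)"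
proof -
  have "(\<lambda>X Y. gns_class (\<lambda>n. X n + Y n)) respects2 gns_rel \<tau>"
  proof (rule congruent2I')
    fix X X' Y Y' assume *: "(X, X') \<in> gns_rel \<tau>" "(Y, Y') \<in> gns_rel \<tau>"
    have "(\<lambda>n. nrm (X n - X' n) + nrm (Y n - Y' n)) \<longlonglongrightarrow> 0"
      using tendsto_add [OF gns_relD [OF *(1)] gns_relD [OF *(2)]] by simp
    hence "(\<lambda>n. nrm (X n + Y n - (X' n + Y' n))) \<longlonglongrightarrow> 0"
      by (rule nrm_squeeze) (simp add: add_diff_add nrm_triangle)
    with * show "gns_class (\<lambda>n. X n + Y n) = gns_class (\<lambda>n. X' n + Y' n)"
      by (intro gns_class_eqI) (simp add: gns_rel_def gns_cauchy_add)
  qed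
  thus ?thesis
    using UN_equiv_class2 [OF equiv_gns_rel equiv_gns_rel] assms by (simp add: gns_space_def)
qed

lemma hinner_gns_class:
  assumes X: "X \<in> gns_cauchy \<tau>" and Y: "Y \<in> gns_cauchy \<tau>"
    and c: "(\<lambda>n. inn (X n) (Y n)) \<longlonglongrightarrow> c"
  shows "hinner H (gns_class X) (gns_class Y) = c"
proof -
  have "(\<lambda>n. inn (X' n) (Y' n)) \<longlonglongrightarrow> c" if "X' \<in> gns_class X" "Y' \<in> gns_class Y" for X' Y'
    using tendsto_add [OF inn_diff_tendsto_0 [of X X' Y Y'] c] that by simp
  moreover have "X \<in> gns_class X" "Y \<in> gns_class Y"
    using equiv_class_self [OF equiv_gns_rel] X Y by auto
  ultimately have "(THE c. \<forall>X\<in>gns_class X. \<forall>Y\<in>gns_class Y. (\<lambda>n. inn (X n) (Y n)) \<longlonglongrightarrow> c) = c"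
    by (intro the_equality) (blast, blast intro: LIMSEQ_unique)
  thus ?thesis by (simp add: gns_space_def)
qed

lemma hnorm_gns_class:
  assumes X: "X \<in> gns_cauchy \<tau>"
  shows "(\<lambda>n. nrm (X n)) \<longlonglongrightarrow> hnorm H (gns_class X)"
proof -
  obtain c where c: "(\<lambda>n. inn (X n) (X n)) \<longlonglongrightarrow> c"
    using inn_convergent [OF X X] by (auto simp: convergent_def)
  hence "hinner H (gns_class X) (gns_class X) = c" by (rule hinner_gns_class [OF X X])
  with c show ?thesis
    unfolding hnorm_def trace_norm_def by (auto intro!: tendsto_intros)
qed


section \<open>Operators induced by bounded maps of the algebra\<close>

definition trace_bounded :: "('a \<Rightarrow> 'a) \<Rightarrow> bool" where
  "trace_bounded L \<longleftrightarrow> (\<forall>x y. L (x + y) = L x + L y) \<and> (\<forall>c x. L (c *\<^sub>C x) = c *\<^sub>C L x) \<and>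
     (\<exists>K\<ge>0. \<forall>x. nrm (L x) \<le> K * nrm x)"

text \<open>This has the shape of \<open>gns_rep\<close>, with left multiplication replaced by any map.  The
  representation, right multiplications and the unitary that implements an automorphism are thus
  instances of one construction.\<close>

definition gns_lift :: "('a \<Rightarrow> 'a) \<Rightarrow> (nat \<Rightarrow> 'a) set \<Rightarrow> (nat \<Rightarrow> 'a) set" where
  "gns_lift L = (\<lambda>p\<in>hcarrier H. \<Union>X\<in>p. gns_class (\<lambda>n. L (X n)))"

lemma trace_bounded_add: "trace_bounded L \<Longrightarrow> L (x + y) = L x + L y"
  and trace_bounded_scaleC: "trace_bounded L \<Longrightarrow> L (c *\<^sub>C x) = c *\<^sub>C L x"
  by (simp_all add: trace_bounded_def)

lemma trace_bounded_diff: "trace_bounded L \<Longrightarrow> L (x - y) = L x - L y"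
  unfolding trace_bounded_def by (metis add_diff_cancel diff_add_cancel)

lemma trace_bounded_cauchy:
  assumes L: "trace_bounded L" and X: "X \<in> gns_cauchy \<tau>"
  shows "(\<lambda>n. L (X n)) \<in> gns_cauchy \<tau>"
proof -
  obtain K where K: "K \<ge> 0" "\<And>x. nrm (L x) \<le> K * nrm x"
    using L by (auto simp: trace_bounded_def)
  show ?thesis
    by (rule gns_cauchy_map2 [OF X gns_cauchy_const [of 0] K(1)])
       (use K(2) in \<open>simp flip: trace_bounded_diff [OF L]\<close>)
qed

lemma gns_lift_class:
  assumes L: "trace_bounded L" and X: "X \<in> gns_cauchy \<tau>"
  shows "gns_lift L (gns_class X) = gns_class (\<lambda>n. L (X n))"
proof -
  obtain K where K: "\<And>x. nrm (L x) \<le> K * nrm x"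
    using L by (auto simp: trace_bounded_def)
  have "(\<lambda>X. gns_class (\<lambda>n. L (X n))) respects gns_rel \<tau>"
  proof (rule congruentI)
    fix X Y assume *: "(X, Y) \<in> gns_rel \<tau>"
    have "(\<lambda>n. K * nrm (X n - Y n)) \<longlonglongrightarrow> 0"
      using tendsto_mult_left [OF gns_relD [OF *], of K] by simp
    hence "(\<lambda>n. nrm (L (X n) - L (Y n))) \<longlonglongrightarrow> 0"
      by (rule nrm_squeeze) (use K in \<open>simp flip: trace_bounded_diff [OF L]\<close>)
    with * show "gns_class (\<lambda>n. L (X n)) = gns_class (\<lambda>n. L (Y n))"
      by (intro gns_class_eqI) (simp add: gns_rel_def trace_bounded_cauchy [OF L])
  qed
  thus ?thesis
    using UN_equiv_class [OF equiv_gns_rel] X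
    by (simp add: gns_lift_def gns_class_in_carrier)
qed

lemma hscale_gns_class:
  assumes "X \<in> gns_cauchy \<tau>"
  shows "hscale H c (gns_class X) = gns_class (\<lambda>n. c *\<^sub>C X n)"
proof -
  have "trace_bounded (\<lambda>x. c *\<^sub>C x)"
    unfolding trace_bounded_def
    by (auto simp: scaleC_add_right scaleC_scaleC nrm_scaleC mult.commute intro!: exI [of _ "cmod c"])
  from gns_lift_class [OF this assms] show ?thesis
    using gns_class_in_carrier [OF assms] by (simp add: gns_lift_def gns_space_def)
qed

lemma gns_lift_eqI:
  assumes "T \<in> extensional (hcarrier H)" "trace_bounded L"
    and "\<And>X. X \<in> gns_cauchy \<tau> \<Longrightarrow> T (gns_class X) = gns_class (\<lambda>n. L (X n))"
  shows "T = gns_lift L"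
proof (rule extensionalityI [OF assms(1)])
  show "gns_lift L \<in> extensional (hcarrier H)" by (simp add: gns_lift_def)
qed (auto elim!: carrier_cases simp: assms gns_lift_class)

lemma gns_lift_bounded:
  assumes L: "trace_bounded L"
  shows "gns_lift L \<in> bounded_ops H"
proof -
  obtain K where K: "\<And>x. nrm (L x) \<le> K * nrm x"
    using L by (auto simp: trace_bounded_def)
  have "hnorm H (gns_lift L p) \<le> K * hnorm H p" if "p \<in> hcarrier H" for p
  proof -
    obtain X where X: "X \<in> gns_cauchy \<tau>" "p = gns_class X" using \<open>p \<in> _\<close> by (rule carrier_cases)
    have "(\<lambda>n. nrm (L (X n))) \<longlonglongrightarrow> hnorm H (gns_lift L p)"
      using hnorm_gns_class [OF trace_bounded_cauchy [OF L X(1)]] X L by (simp add: gns_lift_class)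
    moreover have "(\<lambda>n. K * nrm (X n)) \<longlonglongrightarrow> K * hnorm H p"
      using hnorm_gns_class [OF X(1)] X(2) by (auto intro: tendsto_intros)
    ultimately show ?thesis
      by (rule LIMSEQ_le) (use K in auto)
  qed
  moreover have "gns_lift L \<in> hcarrier H \<rightarrow>\<^sub>E hcarrier H"
    by (rule PiE_I, metis L carrier_cases gns_class_in_carrier gns_lift_class trace_bounded_cauchy)
       (simp add: gns_lift_def)
  moreover have "gns_lift L (hadd H p q) = hadd H (gns_lift L p) (gns_lift L q)"
    if "p \<in> hcarrier H" "q \<in> hcarrier H" for p q
    using that L trace_bounded_cauchy [OF L]
    by (auto elim!: carrier_cases
        simp: gns_lift_class hadd_gns_class gns_cauchy_add trace_bounded_add)
  moreover have "gns_lift L (hscale H c p) = hscale H c (gns_lift L p)"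
    if "p \<in> hcarrier H" for p c
    using that L trace_bounded_cauchy [OF L]
    by (auto elim!: carrier_cases
        simp: gns_lift_class hscale_gns_class gns_cauchy_scaleC trace_bounded_scaleC)
  ultimately show ?thesis by (auto simp: bounded_ops_def)
qed

lemma trace_bounded_comp:
  assumes "trace_bounded L" "trace_bounded M"
  shows "trace_bounded (\<lambda>x. L (M x))"
proof -
  obtain K J where K: "K \<ge> 0" "J \<ge> 0" "\<And>x. nrm (L x) \<le> K * nrm x" "\<And>x. nrm (M x) \<le> J * nrm x"
    using assms by (auto simp: trace_bounded_def)
  have "nrm (L (M x)) \<le> K * J * nrm x" for x
    using K(3) [of "M x"] mult_left_mono [OF K(4) [of x] K(1)] by simp
  with assms K(1,2) show ?thesis
    unfolding trace_bounded_def by (auto intro!: exI [of _ "K * J"])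
qed

lemma gns_lift_mult:
  assumes L: "trace_bounded L" and M: "trace_bounded M"
  shows "op_mult H (gns_lift L) (gns_lift M) = gns_lift (\<lambda>x. L (M x))"
  by (rule gns_lift_eqI)
     (auto simp: op_mult_def gns_class_in_carrier gns_lift_class L M trace_bounded_cauchy
       intro: trace_bounded_comp)

lemma trace_bounded_mult_left: "trace_bounded (\<lambda>x. a * x)"
  unfolding trace_bounded_def
  using nrm_mult_left by (auto simp: distrib_left mult_scaleC_right intro!: exI [of _ "norm a"])

lemma trace_bounded_mult_right: "trace_bounded (\<lambda>x. x * a)"
  unfolding trace_bounded_def
  using nrm_mult_right by (auto simp: distrib_right mult_scaleC_left intro!: exI [of _ "norm a"])

lemma gns_rep_eq_lift: "gns_rep \<tau> a = gns_lift (\<lambda>x. a * x)"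
  by (simp add: gns_rep_def gns_lift_def)

text \<open>Left and right multiplications commute by associativity.\<close>

lemma right_mult_in_commutant: "gns_lift (\<lambda>x. x * a) \<in> commutant H (range (gns_rep \<tau>))"
  by (auto simp: commutant_def gns_lift_bounded trace_bounded_mult_left trace_bounded_mult_right
      gns_rep_eq_lift gns_lift_mult mult.assoc)

lemma gns_rep_in_vn_algebra: "gns_rep \<tau> a \<in> gns_vn_algebra \<tau>"
  by (auto simp: gns_vn_algebra_def commutant_def gns_rep_eq_lift
      intro: gns_lift_bounded trace_bounded_mult_left)

end


section \<open>Conjugation by a unitary\<close>

definition conjugate :: "'h hspace \<Rightarrow> ('h \<Rightarrow> 'h) \<Rightarrow> ('h \<Rightarrow> 'h) \<Rightarrow> ('h \<Rightarrow> 'h) \<Rightarrow> 'h \<Rightarrow> 'h" where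
  "conjugate H U V T = (\<lambda>x\<in>hcarrier H. U (T (V x)))"

lemma bounded_ops_carrier: "T \<in> bounded_ops H \<Longrightarrow> x \<in> hcarrier H \<Longrightarrow> T x \<in> hcarrier H"
  by (auto simp: bounded_ops_def)

lemma bounded_ops_extensional: "T \<in> bounded_ops H \<Longrightarrow> T \<in> extensional (hcarrier H)"
  by (auto simp: bounded_ops_def PiE_def)

lemma commutant_subset_bounded_ops: "commutant H S \<subseteq> bounded_ops H"
  by (auto simp: commutant_def)

text \<open>\<open>U\<close> is a unitary and \<open>V\<close> its inverse.  Closure of the carrier under the linear operations
  is what makes \<open>V\<close> linear too, so that the two are interchangeable.\<close>

locale hspace_symmetry =
  fixes H :: "'h hspace" and U V :: "'h \<Rightarrow> 'h"
  assumes add_closed: "x \<in> hcarrier H \<Longrightarrow> y \<in> hcarrier H \<Longrightarrow> hadd H x y \<in> hcarrier H"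
    and scale_closed: "x \<in> hcarrier H \<Longrightarrow> hscale H c x \<in> hcarrier H"
    and U_carrier: "x \<in> hcarrier H \<Longrightarrow> U x \<in> hcarrier H"
    and V_carrier: "x \<in> hcarrier H \<Longrightarrow> V x \<in> hcarrier H"
    and UV: "x \<in> hcarrier H \<Longrightarrow> U (V x) = x"
    and VU: "x \<in> hcarrier H \<Longrightarrow> V (U x) = x"
    and U_add: "x \<in> hcarrier H \<Longrightarrow> y \<in> hcarrier H \<Longrightarrow> U (hadd H x y) = hadd H (U x) (U y)"
    and U_scale: "x \<in> hcarrier H \<Longrightarrow> U (hscale H c x) = hscale H c (U x)"
    and U_inner: "x \<in> hcarrier H \<Longrightarrow> y \<in> hcarrier H \<Longrightarrow> hinner H (U x) (U y) = hinner H x y"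
begin

lemma V_add: "x \<in> hcarrier H \<Longrightarrow> y \<in> hcarrier H \<Longrightarrow> V (hadd H x y) = hadd H (V x) (V y)"
  by (metis add_closed U_add V_carrier UV VU)

lemma V_scale: "x \<in> hcarrier H \<Longrightarrow> V (hscale H c x) = hscale H c (V x)"
  by (metis scale_closed U_scale V_carrier UV VU)

lemma V_inner: "x \<in> hcarrier H \<Longrightarrow> y \<in> hcarrier H \<Longrightarrow> hinner H (V x) (V y) = hinner H x y"
  by (metis U_inner V_carrier UV)

lemma inverse_symmetry: "hspace_symmetry H V U"
  by unfold_locales
     (simp_all add: add_closed scale_closed U_carrier V_carrier UV VU V_add V_scale V_inner)

abbreviation Ad where "Ad \<equiv> conjugate H U V"

lemma conjugate_bounded:
  assumes T: "T \<in> bounded_ops H"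
  shows "Ad T \<in> bounded_ops H"
proof -
  note carriers = U_carrier V_carrier bounded_ops_carrier [OF T]
  have "\<exists>K. \<forall>x\<in>hcarrier H. hnorm H (T x) \<le> K * hnorm H x"
    using T by (simp add: bounded_ops_def)
  then obtain K where "\<And>x. x \<in> hcarrier H \<Longrightarrow> hnorm H (T x) \<le> K * hnorm H x"
    by blast
  hence "hnorm H (T (V x)) \<le> K * hnorm H (V x)" if "x \<in> hcarrier H" for x
    using that V_carrier by simp
  hence "\<exists>K. \<forall>x\<in>hcarrier H. hnorm H (Ad T x) \<le> K * hnorm H x"
    by (auto simp: conjugate_def hnorm_def U_inner V_inner carriers)
  moreover have "T (hadd H x y) = hadd H (T x) (T y)" "T (hscale H c x) = hscale H c (T x)"
    if "x \<in> hcarrier H" "y \<in> hcarrier H" for x y c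
    using T that by (auto simp: bounded_ops_def)
  ultimately show ?thesis
    by (simp add: bounded_ops_def [of H] conjugate_def U_add V_add U_scale V_scale
        carriers add_closed scale_closed)
qed

lemma conjugate_inverse:
  assumes T: "T \<in> bounded_ops H"
  shows "conjugate H V U (Ad T) = T"
  by (rule extensionalityI [OF _ bounded_ops_extensional [OF T]])
     (auto simp: conjugate_def U_carrier VU bounded_ops_carrier [OF T])

lemma conjugate_mult:
  assumes "T \<in> bounded_ops H"
  shows "Ad (op_mult H S T) = op_mult H (Ad S) (Ad T)"
  by (auto simp: conjugate_def op_mult_def restrict_def fun_eq_iff U_carrier V_carrier VU
      bounded_ops_carrier [OF assms])

lemma conjugate_adjoint:
  assumes "is_adjoint H T S"
  shows "is_adjoint H (Ad T) (Ad S)"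
proof -
  have TS: "T \<in> bounded_ops H" "S \<in> bounded_ops H"
    and adj: "\<And>x y. x \<in> hcarrier H \<Longrightarrow> y \<in> hcarrier H \<Longrightarrow> hinner H (T x) y = hinner H x (S y)"
    using assms by (auto simp: is_adjoint_def)
  have "hinner H (U (T (V x))) y = hinner H x (U (S (V y)))"
    if "x \<in> hcarrier H" "y \<in> hcarrier H" for x y
  proof -
    have "hinner H (U (T (V x))) y = hinner H (T (V x)) (V y)"
      using V_inner [of "U (T (V x))" y] that
      by (simp add: U_carrier V_carrier VU bounded_ops_carrier [OF TS(1)])
    also have "\<dots> = hinner H (V x) (S (V y))"
      using that by (simp add: adj V_carrier)
    also have "\<dots> = hinner H x (U (S (V y)))"
      using V_inner [of x "U (S (V y))"] that
      by (simp add: U_carrier V_carrier VU bounded_ops_carrier [OF TS(2)])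
    finally show ?thesis .
  qed
  with TS show ?thesis
    by (auto simp: is_adjoint_def conjugate_bounded) (auto simp: conjugate_def)
qed

text \<open>If \<open>T\<close> commutes with \<open>R'\<close>, then \<open>Ad T\<close> commutes with \<open>Ad R'\<close>, and every element of \<open>S\<close> has
  the form \<open>Ad R'\<close> with \<open>R' \<in> S\<close>.\<close>

lemma conjugate_commutant_subset:
  assumes S: "S \<subseteq> bounded_ops H" "Ad ` S = S"
  shows "Ad ` commutant H S \<subseteq> commutant H S"
proof clarify
  fix T assume T: "T \<in> commutant H S"
  have "op_mult H (Ad T) R = op_mult H R (Ad T)" if "R \<in> S" for R
  proof -
    obtain R' where R': "R' \<in> S" "R = Ad R'" using \<open>R \<in> S\<close> S(2) by blast
    hence "R' \<in> bounded_ops H" "T \<in> bounded_ops H" "op_mult H T R' = op_mult H R' T"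
      using S(1) T by (auto simp: commutant_def)
    thus ?thesis by (metis R'(2) conjugate_mult)
  qed
  with T show "Ad T \<in> commutant H S"
    by (auto simp: commutant_def conjugate_bounded)
qed

lemma conjugate_commutant:
  assumes S: "S \<subseteq> bounded_ops H" "Ad ` S = S"
  shows "Ad ` commutant H S = commutant H S"
proof
  interpret inv: hspace_symmetry H V U by (rule inverse_symmetry)
  have "conjugate H V U ` S = conjugate H V U ` (Ad ` S)" by (simp add: S)
  also have "\<dots> = S"
    using S(1) by (force simp: image_image conjugate_inverse)
  finally have "conjugate H V U ` commutant H S \<subseteq> commutant H S"
    by (intro inv.conjugate_commutant_subset S(1))
  moreover have "Ad (conjugate H V U T) = T" if "T \<in> commutant H S" for T
    by (rule inv.conjugate_inverse [OF subsetD [OF commutant_subset_bounded_ops that]])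
  ultimately show "commutant H S \<subseteq> Ad ` commutant H S" by (metis image_subset_iff image_eqI subsetI)
qed (rule conjugate_commutant_subset [OF S])

lemma conjugate_star_automorphism:
  assumes M: "M \<subseteq> bounded_ops H" "Ad ` M = M"
  shows "star_automorphism_on H M Ad"
  unfolding star_automorphism_on_def
proof (intro conjI ballI allI impI)
  show "bij_betw Ad M M"
    unfolding bij_betw_def using M conjugate_inverse by (metis inj_on_inverseI subset_iff)
  show "Ad (op_mult H S T) = op_mult H (Ad S) (Ad T)" if "T \<in> M" for S T
    by (rule conjugate_mult [OF subsetD [OF M(1) that]])
  show "Ad (op_add H S T) = op_add H (Ad S) (Ad T)" if "S \<in> M" "T \<in> M" for S T
  proof -
    note carriers = bounded_ops_carrier [OF subsetD [OF M(1) that(1)]]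
      bounded_ops_carrier [OF subsetD [OF M(1) that(2)]]
    show ?thesis
      by (rule ext) (simp add: conjugate_def op_add_def V_carrier U_add carriers)
  qed
  show "Ad (op_scale H c T) = op_scale H c (Ad T)" if "T \<in> M" for c T
    using bounded_ops_carrier [OF subsetD [OF M(1) that]]
    by (intro ext) (simp add: conjugate_def op_scale_def V_carrier U_scale)
qed (rule conjugate_adjoint)

end


section \<open>Extending an automorphism that preserves the trace\<close>

locale trace_automorphism = trace +
  fixes \<phi> :: "'a \<Rightarrow> 'a"
  assumes automorphism: "cstar_automorphism \<phi>"
    and invariant: "\<tau> (\<phi> a) = \<tau> a"
begin

lemma aut_bij: "bij \<phi>"
  and aut_add: "\<phi> (a + b) = \<phi> a + \<phi> b"
  and aut_scaleC: "\<phi> (c *\<^sub>C a) = c *\<^sub>C \<phi> a"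
  and aut_mult: "\<phi> (a * b) = \<phi> a * \<phi> b"
  and aut_star: "\<phi> (star a) = star (\<phi> a)"
  using automorphism by (auto simp: cstar_automorphism_def)

lemma aut_inv: "\<phi> (inv \<phi> a) = a" and inv_aut: "inv \<phi> (\<phi> a) = a"
  using aut_bij by (simp_all add: bij_is_surj bij_is_inj surj_f_inv_f)

lemma inverse_automorphism: "trace_automorphism \<tau> (inv \<phi>)"
proof unfold_locales
  show "cstar_automorphism (inv \<phi>)"
    unfolding cstar_automorphism_def
    by (metis aut_bij bij_imp_bij_inv aut_inv inv_aut aut_add aut_scaleC aut_mult aut_star)
  show "\<tau> (inv \<phi> a) = \<tau> a" for a
    by (metis invariant aut_inv)
qed

lemma inn_aut: "inn (\<phi> x) (\<phi> y) = inn x y"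
  by (simp add: trace_inner_def invariant flip: aut_star aut_mult)

lemma nrm_aut: "nrm (\<phi> x) = nrm x"
  by (simp add: trace_norm_def inn_aut)

text \<open>Invariance of the trace moves \<open>\<phi>\<close> from \<open>a\<close> to \<open>x\<close>, where it preserves the seminorm.\<close>

lemma nrm_aut_mult_left: "nrm (\<phi> a * x) \<le> norm a * nrm x"
proof -
  have "nrm (\<phi> a * x) = nrm (a * inv \<phi> x)"
    using nrm_aut [of "a * inv \<phi> x"] by (simp add: aut_mult aut_inv)
  also have "\<dots> \<le> norm a * nrm (inv \<phi> x)" by (rule nrm_mult_left)
  also have "nrm (inv \<phi> x) = nrm x" using nrm_aut [of "inv \<phi> x"] by (simp add: aut_inv)
  finally show ?thesis .
qed

lemma trace_bounded_aut: "trace_bounded \<phi>"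
  unfolding trace_bounded_def by (auto simp: aut_add aut_scaleC nrm_aut intro: exI [of _ 1])

lemma hinner_lift_aut:
  assumes "p \<in> hcarrier H" "q \<in> hcarrier H"
  shows "hinner H (gns_lift \<phi> p) (gns_lift \<phi> q) = hinner H p q"
proof -
  obtain X Y where XY: "X \<in> gns_cauchy \<tau>" "p = gns_class X" "Y \<in> gns_cauchy \<tau>" "q = gns_class Y"
    using assms by (auto elim!: carrier_cases)
  obtain c where c: "(\<lambda>n. inn (X n) (Y n)) \<longlonglongrightarrow> c"
    using inn_convergent [OF XY(1,3)] by (auto simp: convergent_def)
  have "hinner H (gns_class (\<lambda>n. \<phi> (X n))) (gns_class (\<lambda>n. \<phi> (Y n))) = c"
    using c by (intro hinner_gns_class trace_bounded_cauchy [OF trace_bounded_aut] XY)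
      (simp add: inn_aut)
  moreover have "hinner H (gns_class X) (gns_class Y) = c"
    by (rule hinner_gns_class [OF XY(1,3) c])
  ultimately show ?thesis by (simp add: XY gns_lift_class trace_bounded_aut)
qed

lemma hspace_symmetry_aut: "hspace_symmetry H (gns_lift \<phi>) (gns_lift (inv \<phi>))"
proof -
  interpret inv: trace_automorphism \<tau> "inv \<phi>" by (rule inverse_automorphism)
  note bd = trace_bounded_aut inv.trace_bounded_aut
  note cauchy = bd [THEN trace_bounded_cauchy]
  have U: "gns_lift \<phi> \<in> bounded_ops H" and V: "gns_lift (inv \<phi>) \<in> bounded_ops H"
    by (rule gns_lift_bounded bd)+
  show ?thesis
  proof
    show "hadd H x y \<in> hcarrier H" if "x \<in> hcarrier H" "y \<in> hcarrier H" for x y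
      using that by (auto elim!: carrier_cases
          simp: hadd_gns_class intro!: gns_class_in_carrier gns_cauchy_add)
    show "hscale H c x \<in> hcarrier H" if "x \<in> hcarrier H" for x c
      using that by (auto elim!: carrier_cases
          simp: hscale_gns_class intro!: gns_class_in_carrier gns_cauchy_scaleC)
    show "gns_lift \<phi> (gns_lift (inv \<phi>) x) = x" if "x \<in> hcarrier H" for x
      using that by (auto elim!: carrier_cases
          simp: gns_lift_class bd cauchy aut_inv)
    show "gns_lift (inv \<phi>) (gns_lift \<phi> x) = x" if "x \<in> hcarrier H" for x
      using that by (auto elim!: carrier_cases
          simp: gns_lift_class bd cauchy inv_aut)
    show "gns_lift \<phi> (hadd H x y) = hadd H (gns_lift \<phi> x) (gns_lift \<phi> y)"
      if "x \<in> hcarrier H" "y \<in> hcarrier H" for x y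
      using U that by (simp add: bounded_ops_def)
    show "gns_lift \<phi> (hscale H c x) = hscale H c (gns_lift \<phi> x)" if "x \<in> hcarrier H" for x c
      using U that by (simp add: bounded_ops_def)
  qed (auto intro: bounded_ops_carrier U V hinner_lift_aut)
qed

sublocale sym: hspace_symmetry H "gns_lift \<phi>" "gns_lift (inv \<phi>)"
  by (rule hspace_symmetry_aut)

lemma conjugate_gns_rep: "sym.Ad (gns_rep \<tau> a) = gns_rep \<tau> (\<phi> a)"
proof -
  interpret inv: trace_automorphism \<tau> "inv \<phi>" by (rule inverse_automorphism)
  note bd = trace_bounded_aut inv.trace_bounded_aut trace_bounded_mult_left
  note cauchy = bd [THEN trace_bounded_cauchy]
  show ?thesis
    unfolding gns_rep_eq_lift
    by (rule gns_lift_eqI) (auto simp: conjugate_def gns_lift_class bd cauchy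
        gns_class_in_carrier aut_mult aut_inv)
qed

lemma gns_extension_exists: "\<exists>\<theta>. gns_extension \<tau> \<phi> \<theta>"
proof
  have "range (gns_rep \<tau>) \<subseteq> bounded_ops H"
    by (auto simp: gns_rep_eq_lift gns_lift_bounded trace_bounded_mult_left)
  moreover have "sym.Ad ` range (gns_rep \<tau>) = range (gns_rep \<tau>)"
    using bij_is_surj [OF aut_bij] by (simp add: image_image conjugate_gns_rep)
       (metis image_image)
  ultimately have "sym.Ad ` gns_vn_algebra \<tau> = gns_vn_algebra \<tau>"
    unfolding gns_vn_algebra_def
    by (intro sym.conjugate_commutant commutant_subset_bounded_ops)
  moreover have "gns_vn_algebra \<tau> \<subseteq> bounded_ops H"
    unfolding gns_vn_algebra_def by (rule commutant_subset_bounded_ops)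
  ultimately show "gns_extension \<tau> \<phi> sym.Ad"
    unfolding gns_extension_def
    by (intro conjI allI sym.conjugate_star_automorphism conjugate_gns_rep)
qed


section \<open>Vectors that intertwine an inner extension\<close>

text \<open>The sequence represents \<open>W \<xi>\<close>, where the extension is \<open>Ad W\<close> and \<open>\<xi>\<close> is the class of \<open>1\<close>.\<close>

lemma inner_extension_imp_intertwining_sequence:
  assumes ext: "gns_extension \<tau> \<phi> \<theta>" and inner: "inner_on H (gns_vn_algebra \<tau>) \<theta>"
  obtains X where "X \<in> gns_cauchy \<tau>" "(\<lambda>n. nrm (X n)) \<longlonglongrightarrow> 1"
    "\<And>a. (\<lambda>n. nrm (\<phi> a * X n - X n * a)) \<longlonglongrightarrow> 0"
proof -
  obtain W V where W: "W \<in> gns_vn_algebra \<tau>" and adj: "is_adjoint H W V"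
    and VW: "op_mult H V W = op_id H"
    and Ad: "\<And>T. T \<in> gns_vn_algebra \<tau> \<Longrightarrow> \<theta> T = op_mult H W (op_mult H T V)"
    using inner unfolding inner_on_def by blast
  define \<xi> where "\<xi> = gns_class (\<lambda>_. 1)"
  have \<xi>: "\<xi> \<in> hcarrier H" by (simp add: \<xi>_def gns_class_in_carrier gns_cauchy_const)
  have "W \<xi> \<in> hcarrier H"
    using adj \<xi> by (auto simp: is_adjoint_def intro: bounded_ops_carrier)
  then obtain X where X: "X \<in> gns_cauchy \<tau>" "W \<xi> = gns_class X" by (rule carrier_cases)
  have VW\<xi>: "V (W \<xi>) = \<xi>"
    using fun_cong [OF VW, of \<xi>] \<xi> by (simp add: op_mult_def op_id_def)
  have "hinner H (W \<xi>) (W \<xi>) = hinner H \<xi> \<xi>"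
    using adj \<xi> \<open>W \<xi> \<in> hcarrier H\<close> by (simp add: is_adjoint_def VW\<xi>)
  moreover have "hinner H \<xi> \<xi> = inn 1 1"
    unfolding \<xi>_def by (rule hinner_gns_class) (auto intro: gns_cauchy_const)
  ultimately have "hnorm H (gns_class X) = 1"
    by (simp add: hnorm_def X trace_inner_def trace_one)
  hence "(\<lambda>n. nrm (X n)) \<longlonglongrightarrow> 1" using hnorm_gns_class [OF X(1)] by simp
  moreover have "(\<lambda>n. nrm (\<phi> a * X n - X n * a)) \<longlonglongrightarrow> 0" for a
  proof -
    \<comment> \<open>The vectors \<open>\<pi>(\<phi> a) W \<xi> = W \<pi>(a) \<xi> = W \<rho>(a) \<xi> = \<rho>(a) W \<xi>\<close> agree, where \<open>\<rho>\<close> is right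
      multiplication.\<close>
    let ?\<rho> = "gns_lift (\<lambda>x. x * a)"
    have "gns_class (\<lambda>n. \<phi> a * X n) = gns_rep \<tau> (\<phi> a) (W \<xi>)"
      by (simp add: X gns_rep_eq_lift gns_lift_class trace_bounded_mult_left)
    also have "gns_rep \<tau> (\<phi> a) = op_mult H W (op_mult H (gns_rep \<tau> a) V)"
      using ext Ad [OF gns_rep_in_vn_algebra] by (simp add: gns_extension_def)
    also have "\<dots> (W \<xi>) = W (gns_rep \<tau> a \<xi>)"
      using \<open>W \<xi> \<in> hcarrier H\<close> by (simp add: op_mult_def VW\<xi>)
    also have "gns_rep \<tau> a \<xi> = ?\<rho> \<xi>"
      by (simp add: \<xi>_def gns_rep_eq_lift gns_lift_class gns_cauchy_const
          trace_bounded_mult_left trace_bounded_mult_right)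
    also have "W (?\<rho> \<xi>) = ?\<rho> (W \<xi>)"
    proof -
      have "op_mult H W ?\<rho> = op_mult H ?\<rho> W"
        using W right_mult_in_commutant by (auto simp: gns_vn_algebra_def commutant_def [of _ "commutant _ _"])
      from fun_cong [OF this, of \<xi>] \<xi> show ?thesis by (simp add: op_mult_def)
    qed
    also have "\<dots> = gns_class (\<lambda>n. X n * a)"
      by (simp add: X gns_lift_class trace_bounded_mult_right)
    finally show ?thesis
      by (intro gns_relD gns_class_eqD trace_bounded_cauchy [OF trace_bounded_mult_right X(1)])
  qed
  ultimately show thesis by (rule that [OF X(1)])
qed

text \<open>The convergence along the intertwining sequence \<open>X\<close> depends on \<open>a\<close>, but a single term far out
  serves all contractions at once: replacing it by a later term \<open>X n\<close> changes
  \<open>\<phi> a * x - x * a\<close> by at most \<open>2 nrm (x - X n)\<close>, whatever \<open>a\<close> is.  The element must be fixed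
  before \<open>a\<close>, since the towers are chosen to commute with it.\<close>

lemma inner_extension_imp_almost_intertwiner:
  assumes "gns_extension \<tau> \<phi> \<theta>" "inner_on H (gns_vn_algebra \<tau>) \<theta>" and \<delta>: "\<delta> > 0"
  obtains x where "1/2 \<le> nrm x" "nrm x \<le> 2" "\<And>a. norm a \<le> 1 \<Longrightarrow> nrm (\<phi> a * x - x * a) \<le> \<delta>"
proof -
  obtain X where X: "X \<in> gns_cauchy \<tau>" and lim: "(\<lambda>n. nrm (X n)) \<longlonglongrightarrow> 1"
    and tw: "\<And>a. (\<lambda>n. nrm (\<phi> a * X n - X n * a)) \<longlonglongrightarrow> 0"
    using inner_extension_imp_intertwining_sequence [OF assms(1,2)] by blast
  have "eventually (\<lambda>n. 1/2 < nrm (X n) \<and> nrm (X n) < 2) sequentially"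
    using order_tendstoD(1) [OF lim, of "1/2"] order_tendstoD(2) [OF lim, of 2]
    by (intro eventually_conj) auto
  then obtain N where N: "\<And>n. n \<ge> N \<Longrightarrow> 1/2 < nrm (X n) \<and> nrm (X n) < 2"
    by (auto simp: eventually_sequentially)
  obtain N' where N': "\<And>m n. m \<ge> N' \<Longrightarrow> n \<ge> N' \<Longrightarrow> nrm (X m - X n) < \<delta> / 2"
    using gns_cauchyD [OF X, of "\<delta> / 2"] \<delta> by auto
  define x where "x = X (max N N')"
  have "nrm (\<phi> a * x - x * a) \<le> \<delta>" if a: "norm a \<le> 1" for a
  proof (rule tendsto_lowerbound)
    show "(\<lambda>n. \<delta> + nrm (\<phi> a * X n - X n * a)) \<longlonglongrightarrow> \<delta>"
      using tendsto_add [OF tendsto_const tw, of \<delta>] by simp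
    have "nrm (\<phi> a * x - x * a) \<le> \<delta> + nrm (\<phi> a * X n - X n * a)" if "n \<ge> N'" for n
    proof -
      have x: "nrm (x - X n) \<le> \<delta> / 2" using N' [of "max N N'" n] that by (simp add: x_def)
      have "nrm (\<phi> a * (x - X n)) \<le> 1 * nrm (x - X n)"
        by (rule order.trans [OF nrm_aut_mult_left]) (intro mult_right_mono a nrm_nonneg)
      moreover have "nrm ((x - X n) * a) \<le> 1 * nrm (x - X n)"
        by (rule order.trans [OF nrm_mult_right]) (intro mult_right_mono a nrm_nonneg)
      moreover have "\<phi> a * x - x * a
          = \<phi> a * (x - X n) + (\<phi> a * X n - X n * a) - (x - X n) * a"
        by (simp add: algebra_simps)
      hence "nrm (\<phi> a * x - x * a)
          \<le> nrm (\<phi> a * (x - X n)) + nrm (\<phi> a * X n - X n * a) + nrm ((x - X n) * a)"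
        using nrm_triangle [of "\<phi> a * (x - X n) + (\<phi> a * X n - X n * a)" "- ((x - X n) * a)"]
          nrm_triangle [of "\<phi> a * (x - X n)" "\<phi> a * X n - X n * a"] nrm_minus [of "(x - X n) * a"]
        by simp
      ultimately show ?thesis using x by linarith
    qed
    thus "\<forall>\<^sub>F n in sequentially. nrm (\<phi> a * x - x * a) \<le> \<delta> + nrm (\<phi> a * X n - X n * a)"
      by (auto simp: eventually_sequentially)
  qed simp
  with N [of "max N N'"] show thesis
    by (intro that [of x]) (auto simp: x_def)
qed

text \<open>The vectors \<open>q x\<close> and \<open>p x\<close> differ by at most \<open>4\<epsilon>\<close>, passing through \<open>\<phi>(p) x\<close> and \<open>x p\<close>, while
  \<open>\<langle>q x, p x\<rangle> = \<langle>p q x, x\<rangle>\<close> is at most \<open>4\<epsilon>\<close> in modulus.  Expanding the square of the difference bounds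
  \<open>(nrm (p x))\<^sup>2\<close> by \<open>16\<epsilon>\<^sup>2 + 8\<epsilon>\<close>.\<close>

lemma shifted_element_small:
  assumes p: "star p = p" and x: "nrm x \<le> 2" and \<epsilon>: "0 \<le> \<epsilon>" "\<epsilon> \<le> 1"
    and shift: "norm (\<phi> p - q) \<le> \<epsilon>" and orth: "norm (p * q) \<le> \<epsilon>"
    and central: "norm (p * x - x * p) \<le> \<epsilon>"
    and tw: "nrm (\<phi> p * x - x * p) \<le> \<epsilon>"
  shows "(nrm (p * x))\<^sup>2 \<le> 25 * \<epsilon>"
proof -
  have 1: "nrm ((\<phi> p - q) * x) \<le> \<epsilon> * 2"
    by (rule order.trans [OF nrm_mult_left]) (intro mult_mono shift x \<epsilon> nrm_nonneg)
  have 2: "nrm (p * x - x * p) \<le> \<epsilon>"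
    using nrm_le_norm central by (rule order.trans)
  let ?y = "\<phi> p * x - x * p" and ?z = "p * x - x * p" and ?w = "(\<phi> p - q) * x"
  have "q * x - p * x = (?y + - ?z) + - ?w"
    by (simp add: algebra_simps)
  hence "nrm (q * x - p * x) \<le> nrm (\<phi> p * x - x * p) + nrm (p * x - x * p) + nrm ((\<phi> p - q) * x)"
    using nrm_triangle [of "?y + - ?z" "- ?w"] nrm_triangle [of ?y "- ?z"]
    by (simp only: nrm_minus)
  hence "nrm (q * x - p * x) \<le> 4 * \<epsilon>" using 1 2 tw by linarith
  hence diff: "(nrm (q * x - p * x))\<^sup>2 \<le> (4 * \<epsilon>)\<^sup>2" by (rule power_mono) simp
  have "inn (q * x) (p * x) = inn (p * q * x) x"
    by (simp add: trace_inner_def star_mult p mult.assoc)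
  also have "cmod \<dots> \<le> nrm (p * q * x) * nrm x" by (rule Cauchy_Schwarz)
  also have "nrm (p * q * x) \<le> \<epsilon> * 2"
    by (rule order.trans [OF nrm_mult_left]) (intro mult_mono orth x \<epsilon> nrm_nonneg)
  hence "nrm (p * q * x) * nrm x \<le> (\<epsilon> * 2) * 2"
    by (intro mult_mono x) (use \<epsilon> in auto)
  finally have "Re (inn (q * x) (p * x)) \<le> 4 * \<epsilon>"
    using complex_Re_le_cmod [of "inn (q * x) (p * x)"] by linarith
  hence "(nrm (p * x))\<^sup>2 \<le> (4 * \<epsilon>)\<^sup>2 + 8 * \<epsilon>"
    using nrm_diff_square [of "q * x" "p * x"] diff zero_le_power2 [of "nrm (q * x)"] by linarith
  also have "(4 * \<epsilon>)\<^sup>2 \<le> 16 * \<epsilon>"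
    using \<epsilon> by (simp add: power2_eq_square mult_left_le)
  finally show ?thesis using \<epsilon> by linarith
qed

end


section \<open>Rokhlin towers\<close>

lemma rok_mod_in_box: "n \<ge> 1 \<Longrightarrow> rok_mod n v \<in> rok_box n"
  by (simp add: rok_mod_def rok_box_def)

text \<open>It suffices that \<open>n\<close> exceeds the absolute value of one nonzero coordinate of \<open>v\<close>, so that \<open>n\<close>
  does not divide it.\<close>

lemma rok_mod_shift_neq:
  assumes v: "v \<noteq> 0"
  obtains n where "n \<ge> 1" "\<And>u. u \<in> rok_box n \<Longrightarrow> rok_mod n (u + v) \<noteq> u"
proof -
  obtain i where i: "v $ i \<noteq> 0" using v by (auto simp: vec_eq_iff)
  define n where "n = nat \<bar>v $ i\<bar> + 1"
  have "rok_mod n (u + v) \<noteq> u" for u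
  proof
    assume eq: "rok_mod n (u + v) = u"
    have "(u $ i + v $ i) mod int n = u $ i"
      using arg_cong [OF eq, of "\<lambda>w. w $ i"] by (simp add: rok_mod_def)
    hence "(u $ i + v $ i) mod int n = u $ i mod int n"
      by (metis mod_mod_trivial)
    hence "int n dvd v $ i" by (simp add: mod_eq_dvd_iff)
    with i have "int n \<le> \<bar>v $ i\<bar>" using dvd_imp_le_int [of "v $ i" "int n"] by simp
    thus False by (simp add: n_def)
  qed
  thus thesis by (intro that [of n]) (auto simp: n_def)
qed

lemma dim_rok_finite:
  assumes "dim_rok \<alpha> = enat d"
  shows "\<exists>d. dim_rok_le \<alpha> d"
proof (rule ccontr)
  assume "\<not> ?thesis"
  hence "{d. dim_rok_le \<alpha> d} = {}" by blast
  hence "dim_rok \<alpha> = \<infinity>" by (simp only: dim_rok_def image_empty Inf_empty top_enat_def)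
  with assms show False by simp
qed

lemma dim_rok_le_towers:
  fixes \<alpha> :: "int ^ 'm \<Rightarrow> 'a::unital_cstar_algebra \<Rightarrow> 'a"
  assumes "dim_rok_le \<alpha> d" "finite F" "\<epsilon> > 0" "n \<ge> 1"
  obtains f where
    "\<And>l u. l \<le> d \<Longrightarrow> u \<in> rok_box n \<Longrightarrow> positive (f l u)"
    "\<And>l u. l \<le> d \<Longrightarrow> u \<in> rok_box n \<Longrightarrow> norm (f l u) \<le> 1"
    "\<And>l u w. l \<le> d \<Longrightarrow> u \<in> rok_box n \<Longrightarrow> norm (\<alpha> w (f l u) - f l (rok_mod n (u + w))) < \<epsilon>"
    "\<And>l u u'. l \<le> d \<Longrightarrow> u \<in> rok_box n \<Longrightarrow> u' \<in> rok_box n \<Longrightarrow> u \<noteq> u' \<Longrightarrow>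
      norm (f l u * f l u') < \<epsilon>"
    "\<And>l u a. l \<le> d \<Longrightarrow> u \<in> rok_box n \<Longrightarrow> a \<in> F \<Longrightarrow> norm (f l u * a - a * f l u) < \<epsilon>"
    "norm ((\<Sum>l\<le>d. \<Sum>u\<in>rok_box n. f l u) - 1) < \<epsilon>"
  using assms(1) [unfolded dim_rok_le_def, rule_format, OF assms(2-4)]
  by (elim exE conjE) (rule that; simp)

text \<open>With tolerance \<open>s\<^sup>2\<close>, each of the \<open>N\<close> tower elements contributes at most \<open>5 s\<close> to \<open>nrm x\<close>, and
  the defect of their sum from \<open>1\<close> at most \<open>2 s\<^sup>2\<close>.\<close>

lemma (in trace_automorphism) rokhlin_imp_not_inner:
  fixes \<alpha> :: "int ^ 'm \<Rightarrow> 'a \<Rightarrow> 'a"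
  assumes rok: "dim_rok_le \<alpha> d" and v: "v \<noteq> 0" and \<phi>: "\<phi> = \<alpha> v"
    and ext: "gns_extension \<tau> \<phi> \<theta>"
  shows "\<not> inner_on H (gns_vn_algebra \<tau>) \<theta>"
proof
  assume inner: "inner_on H (gns_vn_algebra \<tau>) \<theta>"
  obtain n where n: "n \<ge> 1" "\<And>u. u \<in> rok_box n \<Longrightarrow> rok_mod n (u + v) \<noteq> u"
    using rok_mod_shift_neq [OF v] by blast
  define N where "N = real (card {..d}) * real (card (rok_box n :: (int ^ 'm) set))"
  have N: "N \<ge> 0" by (simp add: N_def)
  \<comment> \<open>Chosen so that \<open>5 N s + 2 s\<^sup>2 \<le> 5 (N + 1) s = 1/4\<close>, less than the lower bound \<open>1/2\<close> for
    \<open>nrm x\<close>.\<close>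
  define s where "s = 1 / (20 * (N + 1))"
  have s: "0 < s" "s \<le> 1" "20 * ((N + 1) * s) = 1" using N by (auto simp: s_def)
  obtain x where x: "1/2 \<le> nrm x" "nrm x \<le> 2"
    and tw: "\<And>a. norm a \<le> 1 \<Longrightarrow> nrm (\<phi> a * x - x * a) \<le> s\<^sup>2"
    using inner_extension_imp_almost_intertwiner [OF ext inner, of "s\<^sup>2"] s(1)
    by (metis zero_less_power)
  have "finite {x}" "s\<^sup>2 > 0" using s(1) by simp_all
  then obtain f where
    pos: "\<And>l u. l \<le> d \<Longrightarrow> u \<in> rok_box n \<Longrightarrow> positive (f l u)"
      "\<And>l u. l \<le> d \<Longrightarrow> u \<in> rok_box n \<Longrightarrow> norm (f l u) \<le> 1"
    and shift: "\<And>l u w. l \<le> d \<Longrightarrow> u \<in> rok_box n \<Longrightarrow>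
        norm (\<alpha> w (f l u) - f l (rok_mod n (u + w))) < s\<^sup>2"
    and orth: "\<And>l u u'. l \<le> d \<Longrightarrow> u \<in> rok_box n \<Longrightarrow> u' \<in> rok_box n \<Longrightarrow> u \<noteq> u' \<Longrightarrow>
        norm (f l u * f l u') < s\<^sup>2"
    and central: "\<And>l u a. l \<le> d \<Longrightarrow> u \<in> rok_box n \<Longrightarrow> a \<in> {x} \<Longrightarrow>
        norm (f l u * a - a * f l u) < s\<^sup>2"
    and total: "norm ((\<Sum>l\<le>d. \<Sum>u\<in>rok_box n. f l u) - 1) < s\<^sup>2"
    by (rule dim_rok_le_towers [OF rok _ _ n(1)]) (rule that; simp)
  have small: "nrm (f l u * x) \<le> 5 * s" if l: "l \<le> d" and u: "u \<in> rok_box n" for l u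
  proof (rule power2_le_imp_le)
    let ?u' = "rok_mod n (u + v)"
    have u': "?u' \<in> rok_box n" "u \<noteq> ?u'" using n(2) [OF u] rok_mod_in_box [OF n(1)] by simp_all
    have "(nrm (f l u * x))\<^sup>2 \<le> 25 * s\<^sup>2"
    proof (rule shifted_element_small [where q = "f l ?u'"])
      show "star (f l u) = f l u" by (rule positive_imp_selfadjoint [OF pos(1) [OF l u]])
      show "s\<^sup>2 \<le> 1" using s by (simp add: power_le_one)
      show "norm (\<phi> (f l u) - f l ?u') \<le> s\<^sup>2" using shift [OF l u, of v] by (simp only: \<phi> less_imp_le)
      show "norm (f l u * f l ?u') \<le> s\<^sup>2" by (rule less_imp_le [OF orth [OF l u u']])
      show "norm (f l u * x - x * f l u) \<le> s\<^sup>2" by (rule less_imp_le [OF central [OF l u singletonI]])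
      show "nrm (\<phi> (f l u) * x - x * f l u) \<le> s\<^sup>2" by (rule tw [OF pos(2) [OF l u]])
    qed (use x in auto)
    thus "(nrm (f l u * x))\<^sup>2 \<le> (5 * s)\<^sup>2" by (simp add: power_mult_distrib)
  qed (use s in simp)
  let ?F = "\<Sum>l\<le>d. \<Sum>u\<in>rok_box n. f l u"
  have "nrm (?F * x) \<le> (\<Sum>l\<le>d. \<Sum>u\<in>rok_box n. nrm (f l u * x))"
    unfolding sum_distrib_right by (intro order.trans [OF nrm_sum_le] sum_mono nrm_sum_le)
  also have "\<dots> \<le> (\<Sum>l\<le>d. \<Sum>u\<in>(rok_box n :: (int ^ 'm) set). 5 * s)"
    by (intro sum_mono small) auto
  also have "\<dots> = 5 * (N * s)" by (simp add: N_def)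
  finally have "nrm (?F * x) \<le> 5 * (N * s)" .
  moreover have "nrm ((?F - 1) * x) \<le> s\<^sup>2 * 2"
    by (rule order.trans [OF nrm_mult_left]) (intro mult_mono x less_imp_le [OF total], auto)
  moreover have "s\<^sup>2 \<le> s" using s by (simp add: power2_eq_square mult_left_le)
  moreover have "nrm x \<le> nrm (?F * x) + nrm ((?F - 1) * x)"
    using nrm_triangle [of "?F * x" "- ((?F - 1) * x)"] nrm_minus [of "(?F - 1) * x"]
    by (simp add: algebra_simps)
  moreover have "N * s + s = 1 / 20" using s(3) by (simp add: algebra_simps)
  ultimately show False using x(1) mult_nonneg_nonneg [OF N less_imp_le [OF s(1)]] s by linarith
qed

theorem proposition2p3:
  fixes \<alpha> :: "int ^ 'm \<Rightarrow> 'a::unital_cstar_algebra \<Rightarrow> 'a" and d :: nat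
  assumes "(tracial_states :: ('a \<Rightarrow> complex) set) \<noteq> {}"
    and "group_action \<alpha>"
    and "dim_rok \<alpha> = enat d"
  shows "strongly_outer \<alpha>"
  unfolding strongly_outer_def
proof (intro allI impI ballI)
  fix v :: "int ^ 'm" and \<tau> :: "'a \<Rightarrow> complex"
  assume v: "v \<noteq> 0" and \<tau>: "\<tau> \<in> invariant_traces (\<alpha> v)"
  interpret trace_automorphism \<tau> "\<alpha> v"
    using \<tau> assms(2) by unfold_locales (auto simp: invariant_traces_def group_action_def)
  obtain d' where "dim_rok_le \<alpha> d'" using dim_rok_finite [OF assms(3)] by blast
  hence "\<not> inner_on (gns_space \<tau>) (gns_vn_algebra \<tau>) \<theta>"
    if "gns_extension \<tau> (\<alpha> v) \<theta>" for \<theta>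
    using v refl that by (rule rokhlin_imp_not_inner)
  thus "(\<exists>\<theta>. gns_extension \<tau> (\<alpha> v) \<theta>) \<and>
      (\<forall>\<theta>. gns_extension \<tau> (\<alpha> v) \<theta> \<longrightarrow> \<not> inner_on (gns_space \<tau>) (gns_vn_algebra \<tau>) \<theta>)"
    using gns_extension_exists by simp
qed

end
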